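(* Given an $m$-edge graph $H$ as input, for every fixed $k$ with $3\le k \le 9$ the number of subgraphs of $H$ isomorphic to the cycle $C_k$ can be computed in $\widetilde{O}(m^2)$ time.
   Context: $C_k$ is the cycle on $k$ vertices. Model: unit-cost RAM; the host graph is given by a representation allowing adjacency queries in $\widetilde{O}(1)$ time and iteration over all edges $xy$ ordered by $x$ in $\widetilde{O}(m)$ time; $\widetilde{O}$ hides factors polylogarithmic in the input size. *)

theory Defs
  imports Complex_Main
begin

subsection \<open>Graphs and cycles\<close>

type_synonym 'a graph = "'a set \<times> 'a set set"

abbreviation verts :: "'a graph \<Rightarrow> 'a set" where "verts \<equiv> fst"
abbreviation edges :: "'a graph \<Rightarrow> 'a set set" where "edges \<equiv> snd"

definition simple_graph :: "'a graph \<Rightarrow> bool" where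
  "simple_graph G \<longleftrightarrow> finite (verts G) \<and> (\<forall>e\<in>edges G. e \<subseteq> verts G \<and> card e = 2)"

definition subgraph :: "'a graph \<Rightarrow> 'a graph \<Rightarrow> bool" where
  "subgraph S G \<longleftrightarrow> simple_graph S \<and> verts S \<subseteq> verts G \<and> edges S \<subseteq> edges G"

definition isomorphic :: "'a graph \<Rightarrow> 'b graph \<Rightarrow> bool" where
  "isomorphic G H \<longleftrightarrow> (\<exists>f. bij_betw f (verts G) (verts H) \<and> edges H = (\<lambda>e. f ` e) ` edges G)"

definition cycle_graph :: "nat \<Rightarrow> nat graph" where
  "cycle_graph k = ({..<k}, (\<lambda>i. {i, (i + 1) mod k}) ` {..<k})"

definition count_subgraphs :: "'b graph \<Rightarrow> 'a graph \<Rightarrow> nat" where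
  "count_subgraphs F H = card {S. subgraph S H \<and> isomorphic F S}"

subsection \<open>Soft-O\<close>

text \<open>
  The summand 1 is the usual convention that a time bound is at least a constant; it
  matters only where \<open>g\<close> vanishes (edgeless graphs).
\<close>

definition soft_O :: "'i set \<Rightarrow> ('i \<Rightarrow> nat) \<Rightarrow> ('i \<Rightarrow> nat) \<Rightarrow> ('i \<Rightarrow> nat) \<Rightarrow> bool" where
  "soft_O I sz f g \<longleftrightarrow>
     (\<exists>(c::real) (d::nat). \<forall>i\<in>I.
        real (f i) \<le> c * (1 + real (g i)) * log 2 (2 + real (sz i)) ^ d)"

subsection \<open>Represented host graphs\<close>

text \<open>
  A host is a graph on an initial segment of the naturals, the order in which its
  representation enumerates the edges (as ordered pairs, every edge in both directions),
  the time spent on each adjacency query, and the time spent on producing the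
  \<open>i\<close>-th item of the enumeration.
\<close>

record host =
  host_graph :: "nat graph"
  edge_seq :: "(nat \<times> nat) list"
  query_cost :: "nat \<Rightarrow> nat \<Rightarrow> nat"
  next_cost :: "nat \<Rightarrow> nat"

definition valid_host :: "host \<Rightarrow> bool" where
  "valid_host h \<longleftrightarrow>
     simple_graph (host_graph h) \<and>
     verts (host_graph h) = {..<card (verts (host_graph h))} \<and>
     distinct (edge_seq h) \<and>
     set (edge_seq h) = {(x, y). {x, y} \<in> edges (host_graph h)} \<and>
     sorted (map fst (edge_seq h))"

definition num_edges :: "host \<Rightarrow> nat" where
  "num_edges h = card (edges (host_graph h))"

definition input_size :: "host \<Rightarrow> nat" where
  "input_size h = card (verts (host_graph h)) + num_edges h"

definition efficient_representation :: "host set \<Rightarrow> bool" where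
  "efficient_representation R \<longleftrightarrow>
     (\<forall>h\<in>R. valid_host h) \<and>
     soft_O (SIGMA h:R. verts (host_graph h) \<times> verts (host_graph h)) (\<lambda>(h, x, y). input_size h)
       (\<lambda>(h, x, y). query_cost h x y) (\<lambda>_. 1) \<and>
     soft_O R input_size (\<lambda>h. \<Sum>i<length (edge_seq h). next_cost h i) num_edges"

subsection \<open>Unit-cost RAM with access to a host graph\<close>

text \<open>
  Arguments of instructions are constant addresses, except for the constant loaded by
  \<open>Const\<close> and the jump targets. \<open>Load\<close> and \<open>Store\<close> address
  indirectly. Cells hold natural numbers, so \<open>Sub\<close> is truncated. \<open>Next\<close>
  fetches the next ordered pair of the edge enumeration, or jumps if it is exhausted.
\<close>

datatype instr =
    Const nat nat
  | Add nat nat nat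
  | Sub nat nat nat
  | Mul nat nat nat
  | Div nat nat nat
  | Load nat nat
  | Store nat nat
  | Jump nat
  | JumpLess nat nat nat
  | Query nat nat nat
  | Next nat nat nat
  | Rewind

type_synonym program = "instr list"

record state =
  pc :: nat
  mem :: "nat \<Rightarrow> nat"
  pos :: nat
  clock :: nat

definition init_state :: state where
  "init_state = \<lparr>pc = 0, mem = (\<lambda>_. 0), pos = 0, clock = 0\<rparr>"

definition set_cell :: "nat \<Rightarrow> nat \<Rightarrow> state \<Rightarrow> state" where
  "set_cell a v s = s\<lparr>mem := (mem s)(a := v), pc := pc s + 1\<rparr>"

fun exec_instr :: "host \<Rightarrow> instr \<Rightarrow> state \<Rightarrow> state" where
  "exec_instr h (Const a c) s = set_cell a c s"
| "exec_instr h (Add a b c) s = set_cell a (mem s b + mem s c) s"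
| "exec_instr h (Sub a b c) s = set_cell a (mem s b - mem s c) s"
| "exec_instr h (Mul a b c) s = set_cell a (mem s b * mem s c) s"
| "exec_instr h (Div a b c) s = set_cell a (mem s b div mem s c) s"
| "exec_instr h (Load a b) s = set_cell a (mem s (mem s b)) s"
| "exec_instr h (Store a b) s = set_cell (mem s a) (mem s b) s"
| "exec_instr h (Jump l) s = s\<lparr>pc := l\<rparr>"
| "exec_instr h (JumpLess a b l) s = s\<lparr>pc := (if mem s a < mem s b then l else pc s + 1)\<rparr>"
| "exec_instr h (Query a b c) s =
     set_cell a (if {mem s b, mem s c} \<in> edges (host_graph h) then 1 else 0) s"
| "exec_instr h (Next a b l) s =
     (if pos s < length (edge_seq h)
      then s\<lparr>mem := (mem s)(a := fst (edge_seq h ! pos s), b := snd (edge_seq h ! pos s)),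
             pos := pos s + 1, pc := pc s + 1\<rparr>
      else s\<lparr>pc := l\<rparr>)"
| "exec_instr h Rewind s = s\<lparr>pos := 0, pc := pc s + 1\<rparr>"

fun instr_cost :: "host \<Rightarrow> instr \<Rightarrow> state \<Rightarrow> nat" where
  "instr_cost h (Query a b c) s = 1 + query_cost h (mem s b) (mem s c)"
| "instr_cost h (Next a b l) s =
     1 + (if pos s < length (edge_seq h) then next_cost h (pos s) else 0)"
| "instr_cost h _ s = 1"

definition halted :: "program \<Rightarrow> state \<Rightarrow> bool" where
  "halted P s \<longleftrightarrow> pc s \<ge> length P"

definition step :: "program \<Rightarrow> host \<Rightarrow> state \<Rightarrow> state" where
  "step P h s =
     (if halted P s then s
      else (exec_instr h (P ! pc s) s)\<lparr>clock := clock s + instr_cost h (P ! pc s) s\<rparr>)"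

definition run :: "program \<Rightarrow> host \<Rightarrow> nat \<Rightarrow> state" where
  "run P h t = (step P h ^^ t) init_state"

definition halts :: "program \<Rightarrow> host \<Rightarrow> bool" where
  "halts P h \<longleftrightarrow> (\<exists>t. halted P (run P h t))"

definition final_state :: "program \<Rightarrow> host \<Rightarrow> state" where
  "final_state P h = run P h (LEAST t. halted P (run P h t))"

definition result :: "program \<Rightarrow> host \<Rightarrow> nat" where
  "result P h = mem (final_state P h) 0"

definition running_time :: "program \<Rightarrow> host \<Rightarrow> nat" where
  "running_time P h = clock (final_state P h)"

text \<open>
  Unit cost is charged for arithmetic on machine words only: all numbers occurring in a
  run must have a number of bits logarithmic in the input size. Without this, unit-cost
  multiplication of unbounded numbers would make the model unrealistically strong.
\<close>

definition logarithmic_words :: "program \<Rightarrow> host set \<Rightarrow> bool" where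
  "logarithmic_words P R \<longleftrightarrow>
     (\<exists>e::nat. \<forall>h\<in>R. \<forall>t a. mem (run P h t) a \<le> (2 + input_size h) ^ e)"

definition computable_in_soft_O :: "host set \<Rightarrow> (host \<Rightarrow> nat) \<Rightarrow> (host \<Rightarrow> nat) \<Rightarrow> bool" where
  "computable_in_soft_O R f g \<longleftrightarrow>
     (\<exists>P. (\<forall>h\<in>R. halts P h \<and> result P h = f h) \<and>
          logarithmic_words P R \<and>
          soft_O R input_size (running_time P) g)"

end

theory Submission imports Defs "HOL-Library.FuncSet" begin

text \<open>
  The number of copies of \<open>C\<^sub>k\<close> is the number of injective closed walks of length \<open>k\<close> divided
  by the number of automorphisms of \<open>C\<^sub>k\<close>. Expanding the injectivity condition as a product of
  factors \<open>1 - [v\<^sub>i = v\<^sub>j]\<close> turns the number of injective closed walks into a signed sum of numbers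
  of closed walks in which prescribed positions coincide. In such a term a vertex visited only once
  can be summed out, which merges its two arcs into one arc weighted by a number of walks.
  Afterwards every vertex is visited at least twice, so that at most four vertices remain, as
  \<open>k \<le> 9\<close>. If three remain, then some arc is still a single edge; if four remain, then all
  arcs but at most one are single edges and two of these are disjoint, because a star would visit its
  centre too often. Either way the remaining vertices range over pairs of edges or single vertices,
  and there are \<open>O(m\<^sup>2)\<close> possibilities. The numbers of walks of length at most nine between all
  pairs of non-isolated vertices are tabulated in \<open>O(m\<^sup>2)\<close> steps as well.
\<close>

section \<open>Embeddings and subgraphs\<close>

text \<open>Three restrictions shape the program. Subtraction of naturals truncates, so the terms of
  positive and of negative sign are accumulated apart and subtracted only once, when the difference
  is known to be nonnegative; the division by the number of automorphisms comes last and is exact.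
  Every number must stay polynomial in the input size at every moment, so all statements about
  execution carry a bound on the memory, and loops are analysed such that this bound does not
  compound over the iterations. After the input has been read there is only one kind of loop: it
  runs over all pairs (p, q), where p and q are edges or single vertices, and adds products of table
  entries to other table entries. Tabulation fits this scheme, as a walk of length l + 1 from x to y
  is an edge (x, z) followed by a walk of length l from z to y, so that p may run over edges and q
  over vertices. Only the lists of factors and the constant divisor depend on k; they are
  independent of the host and are compiled into the program.\<close>

definition embeddings :: "'b graph \<Rightarrow> 'a graph \<Rightarrow> ('b \<Rightarrow> 'a) set" where
  "embeddings F H = {f \<in> verts F \<rightarrow>\<^sub>E verts H. inj_on f (verts F) \<and> (\<forall>e\<in>edges F. f ` e \<in> edges H)}"

definition automorphisms :: "'b graph \<Rightarrow> ('b \<Rightarrow> 'b) set" where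
  "automorphisms F = {f \<in> verts F \<rightarrow>\<^sub>E verts F. bij_betw f (verts F) (verts F) \<and> edges F = (`) f ` edges F}"

lemma image_restrict_subset: "e \<subseteq> A \<Longrightarrow> restrict f A ` e = f ` e"
  by (intro image_cong) auto

lemma finite_edges: "simple_graph G \<Longrightarrow> finite (edges G)"
  unfolding simple_graph_def by (meson Pow_iff finite_Pow_iff finite_subset subsetI)

lemma finite_subgraphs: "simple_graph H \<Longrightarrow> finite {S. subgraph S H}"
  using finite_edges[of H]
  by (intro finite_subset[of "{S. subgraph S H}" "Pow (verts H) \<times> Pow (edges H)"])
    (auto simp: subgraph_def simple_graph_def)

text \<open>Composition with a fixed isomorphism \<open>g\<close> from \<open>F\<close> to
  \<open>S\<close> is a bijection from the automorphisms of \<open>F\<close> to the isomorphisms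
  from \<open>F\<close> to \<open>S\<close>; \<open>restrict\<close> keeps the composed maps
  extensional.\<close>

lemma card_isomorphisms:
  assumes F: "simple_graph F" and "isomorphic F S"
  shows "card {f \<in> verts F \<rightarrow>\<^sub>E verts S. bij_betw f (verts F) (verts S) \<and> edges S = (`) f ` edges F}
    = card (automorphisms F)"
proof -
  obtain g where g: "bij_betw g (verts F) (verts S)" "edges S = (`) g ` edges F"
    using assms(2) unfolding isomorphic_def by blast
  have sub: "e \<subseteq> verts F" if "e \<in> edges F" for e
    using F that unfolding simple_graph_def by blast
  define gi where "gi = inv_into (verts F) g"
  have gi: "bij_betw gi (verts S) (verts F)" unfolding gi_def using g(1) by (rule bij_betw_inv_into)
  have gig: "gi (g x) = x" if "x \<in> verts F" for x
    using that g(1) unfolding gi_def by (simp add: bij_betw_inv_into_left)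
  have ggi: "g (gi x) = x" if "x \<in> verts S" for x
    using that g(1) unfolding gi_def by (simp add: bij_betw_inv_into_right)
  let ?I = "{f \<in> verts F \<rightarrow>\<^sub>E verts S. bij_betw f (verts F) (verts S) \<and> edges S = (`) f ` edges F}"
  have "bij_betw (\<lambda>a. restrict (g \<circ> a) (verts F)) (automorphisms F) ?I"
  proof (rule bij_betw_byWitness[where f' = "\<lambda>f. restrict (gi \<circ> f) (verts F)"])
    show "\<forall>a\<in>automorphisms F. restrict (gi \<circ> restrict (g \<circ> a) (verts F)) (verts F) = a"
    proof (intro ballI ext)
      fix a x assume "a \<in> automorphisms F"
      then have "a \<in> verts F \<rightarrow>\<^sub>E verts F" by (simp add: automorphisms_def)
      then show "restrict (gi \<circ> restrict (g \<circ> a) (verts F)) (verts F) x = a x"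
        using gig[of "a x"] PiE_mem[of a "verts F" "\<lambda>_. verts F" x] PiE_arb[of a "verts F" "\<lambda>_. verts F" x]
        by (cases "x \<in> verts F") simp_all
    qed
    show "\<forall>f\<in>?I. restrict (g \<circ> restrict (gi \<circ> f) (verts F)) (verts F) = f"
    proof (intro ballI ext)
      fix f x assume "f \<in> ?I"
      then have "f \<in> verts F \<rightarrow>\<^sub>E verts S" by simp
      then show "restrict (g \<circ> restrict (gi \<circ> f) (verts F)) (verts F) x = f x"
        using ggi[of "f x"] PiE_mem[of f "verts F" "\<lambda>_. verts S" x] PiE_arb[of f "verts F" "\<lambda>_. verts S" x]
        by (cases "x \<in> verts F") simp_all
    qed
    show "(\<lambda>a. restrict (g \<circ> a) (verts F)) ` automorphisms F \<subseteq> ?I"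
    proof (rule image_subsetI)
      fix a assume a: "a \<in> automorphisms F"
      then have b: "bij_betw (g \<circ> a) (verts F) (verts S)"
        using g(1) unfolding automorphisms_def by (auto intro: bij_betw_trans)
      have "(`) (restrict (g \<circ> a) (verts F)) ` edges F = (`) (g \<circ> a) ` edges F"
        using sub by (intro image_cong refl image_restrict_subset)
      also have "\<dots> = (`) g ` (`) a ` edges F" by (simp add: image_image image_comp)
      also have "\<dots> = edges S" using a g(2) unfolding automorphisms_def by auto
      finally show "restrict (g \<circ> a) (verts F) \<in> ?I"
        using b bij_betwE[OF b] by (simp cong: bij_betw_cong)
    qed
    show "(\<lambda>f. restrict (gi \<circ> f) (verts F)) ` ?I \<subseteq> automorphisms F"
    proof (rule image_subsetI)
      fix f assume f: "f \<in> ?I"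
      then have b: "bij_betw (gi \<circ> f) (verts F) (verts F)"
        using gi by (auto intro: bij_betw_trans)
      have "(`) (restrict (gi \<circ> f) (verts F)) ` edges F = (`) (gi \<circ> f) ` edges F"
        using sub by (intro image_cong refl image_restrict_subset)
      also have "\<dots> = (`) gi ` (`) f ` edges F" by (simp add: image_image image_comp)
      also have "(`) f ` edges F = (`) g ` edges F" using f g(2) by auto
      also have "(`) gi ` \<dots> = (`) id ` edges F"
        unfolding image_image by (intro image_cong refl) (use gig sub in auto)
      finally show "restrict (gi \<circ> f) (verts F) \<in> automorphisms F"
        using b bij_betwE[OF b] unfolding automorphisms_def by (simp cong: bij_betw_cong)
    qed
  qed
  then show ?thesis by (simp add: bij_betw_same_card)
qed

lemma finite_embeddings:
  assumes "simple_graph F" "simple_graph H"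
  shows "finite (embeddings F H)"
  by (rule finite_subset[of _ "verts F \<rightarrow>\<^sub>E verts H"])
    (use assms in \<open>auto simp: embeddings_def simple_graph_def intro!: finite_PiE\<close>)

text \<open>Embeddings are grouped by the subgraph that they trace out. The fibre over a copy
  \<open>S\<close> of \<open>F\<close> consists of the isomorphisms from \<open>F\<close> to
  \<open>S\<close>, so all fibres have the same size.\<close>

lemma card_embeddings:
  assumes F: "simple_graph F" and H: "simple_graph H"
  shows "card (embeddings F H) = card (automorphisms F) * count_subgraphs F H"
proof -
  define T where "T = {S. subgraph S H \<and> isomorphic F S}"
  define img where "img f = (f ` verts F, (`) f ` edges F)" for f :: "'a \<Rightarrow> 'b"
  have finT: "finite T" unfolding T_def using finite_subgraphs[OF H] by (rule rev_finite_subset) auto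
  have sub: "e \<subseteq> verts F" "card e = 2" if "e \<in> edges F" for e
    using F that unfolding simple_graph_def by blast+
  have inT: "img f \<in> T" if "f \<in> embeddings F H" for f
  proof -
    have f: "f \<in> verts F \<rightarrow>\<^sub>E verts H" "inj_on f (verts F)" "\<forall>e\<in>edges F. f ` e \<in> edges H"
      using that unfolding embeddings_def by auto
    have "card (f ` e) = 2" if "e \<in> edges F" for e
      using sub[OF that] f(2) by (metis card_image inj_on_subset)
    then have "simple_graph (img f)"
      using F sub unfolding img_def simple_graph_def by auto
    moreover have "isomorphic F (img f)" unfolding isomorphic_def img_def
      using f(2) by (auto intro!: exI[of _ f] inj_on_imp_bij_betw)
    ultimately show ?thesis using f unfolding T_def subgraph_def img_def by auto
  qed
  have fib: "{f \<in> embeddings F H. img f = S} =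
      {f \<in> verts F \<rightarrow>\<^sub>E verts S. bij_betw f (verts F) (verts S) \<and> edges S = (`) f ` edges F}"
    if "S \<in> T" for S
  proof -
    have "verts S \<subseteq> verts H" "edges S \<subseteq> edges H" using that unfolding T_def subgraph_def by auto
    then show ?thesis
      unfolding embeddings_def img_def bij_betw_def
      by (cases S) (auto simp: PiE_iff image_subset_iff extensional_def)
  qed
  have "card (embeddings F H) = (\<Sum>f\<in>embeddings F H. 1)" by simp
  also have "\<dots> = (\<Sum>S\<in>T. \<Sum>f\<in>{f \<in> embeddings F H. img f = S}. 1)"
    by (rule sum.group[symmetric]) (use finite_embeddings[OF F H] finT inT in auto)
  also have "\<dots> = (\<Sum>S\<in>T. card (automorphisms F))"
  proof (rule sum.cong[OF refl])
    fix S assume "S \<in> T"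
    then show "(\<Sum>f\<in>{f \<in> embeddings F H. img f = S}. 1) = card (automorphisms F)"
      using card_isomorphisms[OF F, of S] unfolding fib[OF \<open>S \<in> T\<close>] card_eq_sum[symmetric] T_def by blast
  qed
  finally show ?thesis unfolding count_subgraphs_def T_def by simp
qed

lemma automorphisms_pos:
  assumes "simple_graph F" shows "card (automorphisms F) > 0"
proof -
  have "restrict id (verts F) \<in> automorphisms F"
  proof -
    have "restrict id (verts F) ` e = e" if "e \<in> edges F" for e
      using assms that image_restrict_subset[of e "verts F" id] unfolding simple_graph_def by simp
    then show ?thesis unfolding automorphisms_def
      by (auto simp: bij_betw_def inj_on_def image_iff)
  qed
  moreover have "finite (automorphisms F)"
    by (rule finite_subset[of _ "verts F \<rightarrow>\<^sub>E verts F"])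
      (use assms in \<open>auto simp: automorphisms_def simple_graph_def intro!: finite_PiE\<close>)
  ultimately show ?thesis by (auto simp: card_gt_0_iff)
qed

section \<open>Closed walks with identified vertices\<close>

text \<open>The membership test at length 0 makes the numbers vanish at isolated vertices for every
  length.\<close>

fun walks :: "(nat \<times> nat) set \<Rightarrow> nat \<Rightarrow> nat \<Rightarrow> nat \<Rightarrow> nat" where
  "walks D 0 x y = of_bool (x = y \<and> x \<in> Domain D)"
| "walks D (Suc l) x y = (\<Sum>z\<in>Domain D. of_bool ((x, z) \<in> D) * walks D l z y)"

definition graph_relation :: "(nat \<times> nat) set \<Rightarrow> bool" where
  "graph_relation D \<longleftrightarrow> finite D \<and> sym D \<and> irrefl D"

lemma finite_Domain_graph: "graph_relation D \<Longrightarrow> finite (Domain D)"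
  by (simp add: graph_relation_def finite_Domain)

lemma walks_1:
  assumes "graph_relation D"
  shows "walks D (Suc 0) x y = of_bool ((x, y) \<in> D)"
proof -
  have "walks D (Suc 0) x y = (\<Sum>z\<in>Domain D. if z = y then of_bool ((x, y) \<in> D) else 0)"
  proof (unfold walks.simps, intro sum.cong refl)
    fix z assume "z \<in> Domain D"
    then show "of_bool ((x, z) \<in> D) * of_bool (z = y \<and> z \<in> Domain D) = (if z = y then of_bool ((x, y) \<in> D) else (0::nat))"
      by simp
  qed
  also have "\<dots> = of_bool ((x, y) \<in> D)"
  proof (cases "y \<in> Domain D")
    case False
    then have "(x, y) \<notin> D" using assms symD[of D x y] unfolding graph_relation_def by blast
    then show ?thesis by simp
  qed (use finite_Domain_graph[OF assms] in simp)
  finally show ?thesis .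
qed

lemma walks_Domain: "walks D l x y \<noteq> 0 \<Longrightarrow> x \<in> Domain D \<and> y \<in> Domain D"
proof (induction l arbitrary: x)
  case (Suc l)
  then have "(\<Sum>z\<in>Domain D. of_bool ((x, z) \<in> D) * walks D l z y) \<noteq> 0" by simp
  then obtain z where z: "z \<in> Domain D" "of_bool ((x, z) \<in> D) * walks D l z y \<noteq> 0"
    by (rule sum.not_neutral_contains_not_neutral)
  then have "(x, z) \<in> D" "walks D l z y \<noteq> 0" by (simp_all split: if_splits)
  then show ?case using Suc.IH[of z] by blast
qed (simp split: if_splits)

text \<open>Powers of the adjacency matrix multiply: a walk of length \<open>l + l'\<close> is cut
  at the vertex reached after \<open>l\<close> steps. This identity is what makes summing out a
  vertex possible.\<close>

lemma walks_add:
  assumes "graph_relation D"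
  shows "(\<Sum>z\<in>Domain D. walks D l x z * walks D l' z y) = walks D (l + l') x y"
proof (induction l arbitrary: x)
  case 0
  show ?case
  proof (cases "x \<in> Domain D")
    case True
    then have "(\<Sum>z\<in>Domain D. walks D 0 x z * walks D l' z y) =
       (\<Sum>z\<in>Domain D. if x = z then walks D l' z y else 0)"
      by (intro sum.cong) auto
    then show ?thesis using True finite_Domain_graph[OF assms] by simp
  next
    case False
    then show ?thesis using walks_Domain[of D l' x y] by auto
  qed
next
  case (Suc l)
  have "(\<Sum>z\<in>Domain D. walks D (Suc l) x z * walks D l' z y) =
     (\<Sum>z\<in>Domain D. \<Sum>w\<in>Domain D. of_bool ((x, w) \<in> D) * (walks D l w z * walks D l' z y))"
    by (simp add: sum_distrib_right mult.assoc)
  also have "\<dots> = (\<Sum>w\<in>Domain D. \<Sum>z\<in>Domain D. of_bool ((x, w) \<in> D) * (walks D l w z * walks D l' z y))"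
    by (rule sum.swap)
  also have "\<dots> = (\<Sum>w\<in>Domain D. of_bool ((x, w) \<in> D) * walks D (l + l') w y)"
    by (simp only: sum_distrib_left[symmetric] Suc.IH)
  finally show ?case by simp
qed

text \<open>
  A list of pairs \<open>(x, l)\<close> stands for a closed walk through the variables \<open>x\<close> in this cyclic order,
  where the arc that leaves \<open>x\<close> is a walk of length \<open>l\<close>. An arc of length \<open>l\<close> from \<open>x\<close> to \<open>y\<close> is
  represented by the triple \<open>(l, x, y)\<close>.
\<close>

fun first_var :: "(nat \<times> nat) list \<Rightarrow> nat \<Rightarrow> nat" where
  "first_var [] z = z"
| "first_var ((x, l) # xs) z = x"

fun arcs_to :: "(nat \<times> nat) list \<Rightarrow> nat \<Rightarrow> (nat \<times> nat \<times> nat) list" where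
  "arcs_to [] z = []"
| "arcs_to ((x, l) # xs) z = (l, x, first_var xs z) # arcs_to xs z"

definition cycle_arcs :: "(nat \<times> nat) list \<Rightarrow> (nat \<times> nat \<times> nat) list" where
  "cycle_arcs xs = arcs_to xs (fst (hd xs))"

text \<open>The table \<open>T\<close> is left open because such products are evaluated both for the
  exact numbers of walks and for tables that are only partly filled.\<close>

definition monomial ::
  "(nat \<Rightarrow> nat \<Rightarrow> nat \<Rightarrow> nat) \<Rightarrow> (nat \<times> nat \<times> nat) list \<Rightarrow> (nat \<Rightarrow> nat) \<Rightarrow> nat" where
  "monomial T fs v = (\<Prod>(l, i, j)\<leftarrow>fs. T l (v i) (v j))"

definition cycle_sum :: "(nat \<times> nat) set \<Rightarrow> (nat \<times> nat) list \<Rightarrow> nat" where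
  "cycle_sum D xs = (\<Sum>g\<in>fst ` set xs \<rightarrow>\<^sub>E Domain D. monomial (walks D) (cycle_arcs xs) g)"

lemma monomial_Nil [simp]: "monomial T [] v = 1"
  and monomial_Cons [simp]: "monomial T ((l, i, j) # fs) v = T l (v i) (v j) * monomial T fs v"
  and monomial_append [simp]: "monomial T (fs @ gs) v = monomial T fs v * monomial T gs v"
  by (simp_all add: monomial_def)

lemma arcs_to_append: "arcs_to (xs @ ys) z = arcs_to xs (first_var ys z) @ arcs_to ys z"
proof (induction xs z rule: arcs_to.induct)
  case (2 x l xs z)
  then show ?case by (cases xs) auto
qed simp

lemma first_var_hd: "xs \<noteq> [] \<Longrightarrow> first_var xs z = fst (hd xs)"
  by (cases xs) auto

text \<open>A closed walk has no distinguished start. Rotation serves to place a vertex behind its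
  predecessor before it is summed out, and to move a single long arc to the end of the list.\<close>

lemma cycle_sum_rotate: "cycle_sum D (xs @ ys) = cycle_sum D (ys @ xs)"
proof (cases "xs = [] \<or> ys = []")
  case False
  then have "monomial (walks D) (cycle_arcs (xs @ ys)) g = monomial (walks D) (cycle_arcs (ys @ xs)) g" for g
    by (simp add: cycle_arcs_def arcs_to_append first_var_hd)
  then show ?thesis by (simp add: cycle_sum_def Un_commute image_Un)
qed auto

lemma arcs_to_vars: "(l, x, y) \<in> set (arcs_to xs z) \<Longrightarrow> x \<in> fst ` set xs \<and> y \<in> insert z (fst ` set xs)"
proof (induction xs z rule: arcs_to.induct)
  case (2 x l xs z)
  then show ?case by (cases xs) auto
qed simp

lemma cycle_arcs_vars:
  "(l, x, y) \<in> set (cycle_arcs xs) \<Longrightarrow> x \<in> fst ` set xs \<and> y \<in> fst ` set xs"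
  using arcs_to_vars[of l x y xs "fst (hd xs)"] unfolding cycle_arcs_def by (cases xs) auto

lemma arcs_to_lengths: "(l, x, y) \<in> set (arcs_to xs z) \<Longrightarrow> l \<in> snd ` set xs"
  by (induction xs z rule: arcs_to.induct) auto

lemma monomial_cong:
  assumes "\<And>l i j. (l, i, j) \<in> set fs \<Longrightarrow> T l (v i) (v j) = T' l (v' i) (v' j)"
  shows "monomial T fs v = monomial T' fs v'"
  unfolding monomial_def using assms by (intro arg_cong[of _ _ prod_list] map_cong) auto

lemma monomial_zero: "(l, i, j) \<in> set fs \<Longrightarrow> T l (v i) (v j) = 0 \<Longrightarrow> monomial T fs v = 0"
  by (force simp: monomial_def prod_list_zero_iff)

lemma sum_PiE_insert:
  assumes "finite V" "u \<notin> V"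
  shows "(\<Sum>g\<in>insert u V \<rightarrow>\<^sub>E L. F g) = (\<Sum>g\<in>V \<rightarrow>\<^sub>E L. \<Sum>z\<in>L. (F (g(u := z)) :: nat))"
proof -
  have "(\<Sum>g\<in>insert u V \<rightarrow>\<^sub>E L. F g) = (\<Sum>(z, g)\<in>L \<times> (V \<rightarrow>\<^sub>E L). F (g(u := z)))"
    unfolding PiE_insert_eq
    by (subst sum.reindex) (use inj_combinator[OF assms(2), of "\<lambda>_. L"] in \<open>auto simp: case_prod_unfold\<close>)
  also have "\<dots> = (\<Sum>z\<in>L. \<Sum>g\<in>V \<rightarrow>\<^sub>E L. F (g(u := z)))"
    by (rule sum.cartesian_product[symmetric])
  finally show ?thesis by (subst sum.swap)
qed

text \<open>The value of \<open>u\<close> enters just two factors, the arc from \<open>w\<close> to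
  \<open>u\<close> and the arc leaving \<open>u\<close>; summing over it joins them by
  \<open>walks_add\<close>.\<close>

lemma cycle_sum_eliminate:
  assumes D: "graph_relation D" and u: "u \<noteq> w" "u \<notin> fst ` set zs"
  shows "cycle_sum D ((w, l') # (u, l) # zs) = cycle_sum D ((w, l' + l) # zs)"
proof -
  let ?V = "insert w (fst ` set zs)"
  have V: "finite ?V" "u \<notin> ?V" using u by auto
  have eq: "fst ` set ((w, l') # (u, l) # zs) = insert u ?V" by auto
  \<comment> \<open>The successor of \<open>u\<close>, which is \<open>w\<close> again if
    \<open>zs\<close> is empty.\<close>
  define y where "y = first_var zs w"
  have "y \<in> ?V" unfolding y_def by (cases zs) auto
  with V have uy: "u \<noteq> y" by auto
  have "(\<Sum>z\<in>Domain D. monomial (walks D) (cycle_arcs ((w, l') # (u, l) # zs)) (g(u := z)))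
      = monomial (walks D) (cycle_arcs ((w, l' + l) # zs)) g" for g
  proof -
    have m: "monomial (walks D) (arcs_to zs w) (g(u := z)) = monomial (walks D) (arcs_to zs w) g" for z
      using V(2) by (intro monomial_cong) (auto dest!: arcs_to_vars)
    show ?thesis
      using u(1) uy
      by (simp add: cycle_arcs_def m y_def[symmetric] walks_add[OF D, symmetric] sum_distrib_right mult.assoc)
  qed
  then show ?thesis
    unfolding cycle_sum_def eq sum_PiE_insert[OF V] by simp
qed

section \<open>Sums over pairs of edges or vertices\<close>

text \<open>
  The diagonal pairs are included so that a single double loop also serves when fewer than four
  vertices remain: a factor \<open>walks D 0\<close> forces two coordinates to agree. Coordinate 4 is constantly 0
  and addresses the accumulators of the program.
\<close>

definition edge_pairs :: "(nat \<times> nat) set \<Rightarrow> (nat \<times> nat) set" where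
  "edge_pairs D = D \<union> Id_on (Domain D)"

definition quad :: "nat \<times> nat \<Rightarrow> nat \<times> nat \<Rightarrow> nat \<Rightarrow> nat" where
  "quad p q t = [fst p, snd p, fst q, snd q, 0] ! t"

lemma quad_simps [simp]: "quad p q 0 = fst p" "quad p q (Suc 0) = snd p"
   "quad p q 2 = fst q" "quad p q 3 = snd q" "quad p q 4 = 0"
  by (simp_all add: quad_def numeral_eq_Suc)

definition quad_sum :: "(nat \<times> nat) set \<Rightarrow> (nat \<times> nat \<times> nat) list \<Rightarrow> nat" where
  "quad_sum D fs = (\<Sum>p\<in>edge_pairs D. \<Sum>q\<in>edge_pairs D. monomial (walks D) fs (quad p q))"

definition small_factors :: "(nat \<times> nat \<times> nat) list \<Rightarrow> bool" where
  "small_factors fs \<longleftrightarrow> (\<forall>(l, i, j)\<in>set fs. l \<le> 9 \<and> i < 4 \<and> j < 4)"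

text \<open>One list of factors has to serve all \<open>D\<close>, since it becomes part of the
  program.\<close>

definition quad_countable :: "(nat \<times> nat) list \<Rightarrow> bool" where
  "quad_countable xs \<longleftrightarrow>
     (\<exists>fs. small_factors fs \<and> (\<forall>D. graph_relation D \<longrightarrow> cycle_sum D xs = quad_sum D fs))"

lemma finite_edge_pairs: "graph_relation D \<Longrightarrow> finite (edge_pairs D)"
  using finite_Domain_graph by (auto simp: edge_pairs_def graph_relation_def Id_on_def)

lemma less_4: "(i::nat) < 4 \<longleftrightarrow> i = 0 \<or> i = Suc 0 \<or> i = 2 \<or> i = 3" by auto

text \<open>In a nonzero term an arc of length 1 forces its ends to be adjacent, so
  \<open>(p, q)\<close> and \<open>(s, t)\<close> take values in \<open>edge_pairs D\<close> and
  determine the whole assignment. The four names need not be distinct: a repeated variable occupies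
  several coordinates, which extra factors force to agree.\<close>

lemma quad_countableI:
  assumes xs: "\<forall>(x, l)\<in>set xs. l \<le> 9"
    and V: "fst ` set xs = {p, q, s, t}"
    and pq: "p = q \<or> (1, p, q) \<in> set (cycle_arcs xs)"
    and st: "s = t \<or> (1, s, t) \<in> set (cycle_arcs xs)"
  shows "quad_countable xs"
proof -
  define e where "e i = [p, q, s, t] ! i" for i :: nat
  have e [simp]: "e 0 = p" "e (Suc 0) = q" "e 2 = s" "e 3 = t" by (simp_all add: e_def numeral_eq_Suc)
  \<comment> \<open>One coordinate is singled out for each variable; the factors of the arcs refer
    to it alone.\<close>
  define \<tau> where "\<tau> v = (SOME i. i < 4 \<and> e i = v)" for v
  have ex: "\<exists>i. i < 4 \<and> e i = v" if "v \<in> {p, q, s, t}" for v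
  proof -
    have "e 0 = v \<or> e (Suc 0) = v \<or> e 2 = v \<or> e 3 = v" using that by auto
    then show ?thesis by (elim disjE) (rule exI, rule conjI[rotated], assumption, simp)+
  qed
  have \<tau>: "\<tau> v < 4" "e (\<tau> v) = v" if "v \<in> {p, q, s, t}" for v
    using someI_ex[OF ex[OF that]] unfolding \<tau>_def by auto
  \<comment> \<open>The appended factors of length 0 force every coordinate to be a non-isolated
    vertex and to equal the chosen coordinate of its variable.\<close>
  define fs where "fs = map (\<lambda>(l, x, y). (l, \<tau> x, \<tau> y)) (cycle_arcs xs) @
     map (\<lambda>i. (0, i, \<tau> (e i))) [0, 1, 2, 3]"
  have e_mem: "e i \<in> {p, q, s, t}" if "i < 4" for i using that by (auto simp: less_4)
  have small: "small_factors fs"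
  proof -
    have 1: "l \<le> 9 \<and> \<tau> x < 4 \<and> \<tau> y < 4" if a: "(l, x, y) \<in> set (cycle_arcs xs)" for l x y
    proof -
      obtain z where "(z, l) \<in> set xs" using arcs_to_lengths[of l x y xs "fst (hd xs)"] a unfolding cycle_arcs_def by auto
      then show ?thesis using xs \<tau>(1) cycle_arcs_vars[OF a] V by auto
    qed
    have 2: "\<tau> (e i) < 4" if "i < 4" for i using \<tau>(1)[OF e_mem[OF that]] .
    show ?thesis
      unfolding small_factors_def fs_def using 1 2[of 0] 2[of 1] 2[of 2] 2[of 3] by auto
  qed
  have "cycle_sum D xs = quad_sum D fs" if D: "graph_relation D" for D
  proof -
    have mono: "monomial (walks D) fs v =
       monomial (walks D) (cycle_arcs xs) (\<lambda>x. v (\<tau> x)) * (\<Prod>i\<leftarrow>[0,1,2,3]. walks D 0 (v i) (v (\<tau> (e i))))" for v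
      unfolding fs_def by (simp add: monomial_def o_def case_prod_unfold)
    have nz: "monomial (walks D) (cycle_arcs xs) (\<lambda>x. v (\<tau> x)) \<noteq> 0 \<and>
        (\<forall>i<4. v i = v (\<tau> (e i)) \<and> v i \<in> Domain D)" if "monomial (walks D) fs v \<noteq> 0" for v
      using that unfolding mono by (auto simp: less_4)
    \<comment> \<open>Only after the vanishing terms are removed do assignments and pairs of pairs
      correspond one to one.\<close>
    let ?S' = "{ab \<in> edge_pairs D \<times> edge_pairs D. monomial (walks D) fs (quad (fst ab) (snd ab)) = 0}"
    let ?T' = "{g \<in> {p, q, s, t} \<rightarrow>\<^sub>E Domain D. monomial (walks D) (cycle_arcs xs) g = 0}"
    let ?j = "\<lambda>ab. restrict (\<lambda>v. quad (fst ab) (snd ab) (\<tau> v)) {p, q, s, t}"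
    have "quad_sum D fs = (\<Sum>(a, b)\<in>edge_pairs D \<times> edge_pairs D. monomial (walks D) fs (quad a b))"
      unfolding quad_sum_def by (rule sum.cartesian_product)
    also have "\<dots> = (\<Sum>(a, b)\<in>edge_pairs D \<times> edge_pairs D - ?S'. monomial (walks D) fs (quad a b))"
      by (rule sum.mono_neutral_right) (auto simp: finite_edge_pairs[OF D])
    also have "\<dots> = (\<Sum>g\<in>({p, q, s, t} \<rightarrow>\<^sub>E Domain D) - ?T'. monomial (walks D) (cycle_arcs xs) g)"
    proof (rule sum.reindex_bij_witness[
          where i = "\<lambda>g. ((g p, g q), (g s, g t))"
          and j = ?j])
      have restr: "monomial (walks D) (cycle_arcs xs) (restrict v {p, q, s, t}) = monomial (walks D) (cycle_arcs xs) v" for v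
        using V by (intro monomial_cong) (auto dest!: cycle_arcs_vars)
      {
        fix ab assume ab: "ab \<in> edge_pairs D \<times> edge_pairs D - ?S'"
        obtain a1 a2 b1 b2 where abe: "ab = ((a1, a2), (b1, b2))" by (metis surj_pair)
        define v where "v = quad (fst ab) (snd ab)"
        have v: "monomial (walks D) (cycle_arcs xs) (\<lambda>x. v (\<tau> x)) \<noteq> 0"
          "\<And>i. i < 4 \<Longrightarrow> v (\<tau> (e i)) = v i" "\<And>i. i < 4 \<Longrightarrow> v i \<in> Domain D"
        proof -
          have "monomial (walks D) fs v \<noteq> 0" using ab unfolding v_def by blast
          then show "monomial (walks D) (cycle_arcs xs) (\<lambda>x. v (\<tau> x)) \<noteq> 0"
            "\<And>i. i < 4 \<Longrightarrow> v (\<tau> (e i)) = v i" "\<And>i. i < 4 \<Longrightarrow> v i \<in> Domain D"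
            using nz[of v] by metis+
        qed
        have vv: "v (\<tau> p) = a1" "v (\<tau> q) = a2" "v (\<tau> s) = b1" "v (\<tau> t) = b2"
          using v(2)[of 0] v(2)[of 1] v(2)[of 2] v(2)[of 3] by (simp_all add: v_def abe)
        show "((?j ab p, ?j ab q), (?j ab s, ?j ab t)) = ab"
          using vv unfolding v_def by (simp add: abe)
        show "?j ab \<in> ({p, q, s, t} \<rightarrow>\<^sub>E Domain D) - ?T'"
          unfolding v_def[symmetric] using v \<tau> by (auto simp: restr)
        have "(\<Prod>i\<leftarrow>[0,1,2,3]. walks D 0 (v i) (v (\<tau> (e i)))) = 1"
          using v(2,3)[of 0] v(2,3)[of 1] v(2,3)[of 2] v(2,3)[of 3] by simp
        then show "monomial (walks D) (cycle_arcs xs) (?j ab)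
           = (case ab of (a, b) \<Rightarrow> monomial (walks D) fs (quad a b))"
          using mono[of v] by (simp add: restr case_prod_unfold v_def)
      next
        fix g assume g: "g \<in> ({p, q, s, t} \<rightarrow>\<^sub>E Domain D) - ?T'"
        define v where "v = quad (g p, g q) (g s, g t)"
        have ve: "v i = g (e i)" if "i < 4" for i using that by (auto simp: less_4 v_def)
        have v\<tau>: "v (\<tau> x) = g x" if "x \<in> {p, q, s, t}" for x using ve[of "\<tau> x"] \<tau>[OF that] by simp
        show "?j ((g p, g q), (g s, g t)) = g"
        proof
          fix x
          show "?j ((g p, g q), (g s, g t)) x = g x"
            using v\<tau>[of x] PiE_arb[of g "{p, q, s, t}" "\<lambda>_. Domain D" x] g
            unfolding v_def by (cases "x \<in> {p, q, s, t}") simp_all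
        qed
        have nz: "monomial (walks D) (cycle_arcs xs) g \<noteq> 0" using g by auto
        have gD: "g x \<in> Domain D" if "x \<in> {p, q, s, t}" for x using that g by auto
        have in1: "(g x, g y) \<in> edge_pairs D"
          if "x = y \<or> (1, x, y) \<in> set (cycle_arcs xs)" "x \<in> {p, q, s, t}" for x y
          using that gD[of x] monomial_zero[of 1 x y "cycle_arcs xs" "walks D" g] nz walks_1[OF D]
          by (auto simp: edge_pairs_def)
        have "monomial (walks D) (cycle_arcs xs) (\<lambda>x. v (\<tau> x)) = monomial (walks D) (cycle_arcs xs) g"
        proof (rule monomial_cong)
          fix l x y assume "(l, x, y) \<in> set (cycle_arcs xs)"
          then show "walks D l (v (\<tau> x)) (v (\<tau> y)) = walks D l (g x) (g y)"
            using cycle_arcs_vars[of l x y xs] v\<tau>[of x] v\<tau>[of y] V by simp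
        qed
        moreover have "(\<Prod>i\<leftarrow>[0,1,2,3]. walks D 0 (v i) (v (\<tau> (e i)))) = 1"
          using ve v\<tau> gD by simp
        ultimately have "monomial (walks D) fs v = monomial (walks D) (cycle_arcs xs) g"
          unfolding mono by simp
        then show "((g p, g q), (g s, g t)) \<in> edge_pairs D \<times> edge_pairs D - ?S'"
          using in1 pq st nz by (auto simp: v_def)
      }
    qed
    also have "\<dots> = cycle_sum D xs"
      unfolding cycle_sum_def V
      by (rule sum.mono_neutral_left) (use finite_Domain_graph[OF D] in \<open>auto intro!: finite_PiE\<close>)
    finally show ?thesis ..
  qed
  then show ?thesis using small unfolding quad_countable_def by blast
qed

section \<open>Patterns of at most nine steps reduce to pairs of edges\<close>

lemma quad_countable_cong:
  assumes "\<And>D. graph_relation D \<Longrightarrow> cycle_sum D xs = cycle_sum D ys" "quad_countable ys"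
  shows "quad_countable xs"
  using assms unfolding quad_countable_def by auto

lemma quad_countable_rotate: "quad_countable (ys @ xs) \<Longrightarrow> quad_countable (xs @ ys)"
  by (rule quad_countable_cong[of _ "ys @ xs"]) (auto intro: cycle_sum_rotate)

lemma length_arcs_to [simp]: "length (arcs_to xs z) = length xs"
  by (induction xs z rule: arcs_to.induct) auto

lemma nth_arcs_to:
  "i < length xs \<Longrightarrow> arcs_to xs z ! i =
     (snd (xs ! i), fst (xs ! i), if Suc i < length xs then fst (xs ! Suc i) else z)"
proof (induction xs z arbitrary: i rule: arcs_to.induct)
  case (2 x l xs z)
  then show ?case by (cases xs; cases i) auto
qed simp

lemma cycle_arcs_nth:
  assumes "Suc i < length xs"
  shows "(snd (xs ! i), fst (xs ! i), fst (xs ! Suc i)) \<in> set (cycle_arcs xs)"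
  using nth_arcs_to[of i xs "fst (hd xs)"] assms nth_mem[of i "cycle_arcs xs"]
  by (simp add: cycle_arcs_def)

lemma cycle_arcs_from:
  assumes "(p, l) \<in> set xs" shows "\<exists>q. (l, p, q) \<in> set (cycle_arcs xs)"
proof -
  obtain i where "i < length xs" "xs ! i = (p, l)" using assms by (metis in_set_conv_nth)
  then show ?thesis
    using nth_arcs_to[of i xs "fst (hd xs)"] nth_mem[of i "cycle_arcs xs"]
    by (auto simp: cycle_arcs_def split: if_splits)
qed

text \<open>An arc of length 1 from a variable to itself asks for a loop of an irreflexive relation,
  so the sum is 0. The list \<open>[(1, 0, 0)]\<close> represents this value, as each of its terms
  is a loop as well.\<close>

lemma quad_countable_loop:
  assumes "(1, p, p) \<in> set (cycle_arcs xs)" shows "quad_countable xs"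
proof -
  have "cycle_sum D xs = quad_sum D [(1, 0, 0)]" if D: "graph_relation D" for D
  proof -
    have z: "walks D 1 x x = 0" for x
      using D walks_1[OF D, of x x] by (auto simp: graph_relation_def irrefl_def)
    have "cycle_sum D xs = 0" "quad_sum D [(1, 0, 0)] = 0"
      unfolding cycle_sum_def quad_sum_def
      using monomial_zero[OF assms, of "walks D"] z by simp_all
    then show ?thesis by simp
  qed
  then show ?thesis unfolding quad_countable_def
    by (intro exI[of _ "[(1, 0, 0)]"]) (auto simp: small_factors_def)
qed

text \<open>The only other possibility, a triangle, covers just three points.\<close>

lemma intersecting_pairs_star:
  assumes pairs: "\<forall>e\<in>E. card e = 2" and int: "\<forall>e\<in>E. \<forall>f\<in>E. e \<inter> f \<noteq> {}"
    and fin: "finite (\<Union>E)" and four: "card (\<Union>E) \<ge> 4"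
  shows "\<exists>c. \<forall>e\<in>E. c \<in> e"
proof -
  have "E \<noteq> {}" using four by auto
  then obtain e0 where e0: "e0 \<in> E" by blast
  then obtain a b where ab: "e0 = {a, b}" "a \<noteq> b" using pairs by (metis card_2_iff)
  have ex: "\<exists>x\<in>\<Union>E. x \<notin> S" if "finite S" "card S < 4" for S
    using that four card_mono[of S "\<Union>E"] by (meson leD le_trans subsetI)
  obtain c where c: "c \<in> \<Union>E" "c \<notin> {a, b}" using ex[of "{a, b}"] ab by auto
  then obtain e1 where e1: "e1 \<in> E" "c \<in> e1" by blast
  have "e1 \<inter> {a, b} \<noteq> {}" using int e1(1) e0 ab(1) by blast
  then obtain x where x: "x \<in> {a, b}" "x \<in> e1" by blast
  have "e1 = {x, c}" using pairs e1 x c(2) by (auto simp: card_2_iff)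
  obtain y where y: "{x, y} = {a, b}" "y \<noteq> x" using x ab by blast
  have "card {a, b, c} < 4" by (simp add: card_insert_if)
  then obtain d where d: "d \<in> \<Union>E" "d \<notin> {a, b, c}" using ex[of "{a, b, c}"] by blast
  then obtain e2 where e2: "e2 \<in> E" "d \<in> e2" by blast
  have i2: "e2 \<inter> {x, y} \<noteq> {}" "e2 \<inter> {x, c} \<noteq> {}"
    using int e2(1) e0 e1(1) ab(1) y(1) \<open>e1 = {x, c}\<close> by blast+
  obtain d' where d': "e2 = {d, d'}" "d \<noteq> d'"
  proof -
    have "card e2 = 2" using pairs e2(1) by blast
    then obtain y1 y2 where "e2 = {y1, y2}" "y1 \<noteq> y2" by (meson card_2_iff)
    then show ?thesis using e2(2) that[of y1] that[of y2] by blast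
  qed
  have "d \<noteq> x" "d \<noteq> y" "d \<noteq> c" "c \<noteq> y" "c \<noteq> x" using d(2) y(1) c(2) by auto
  \<comment> \<open>Besides \<open>d\<close>, the pair \<open>e2\<close> has one element left, which
    must lie in both \<open>{x, y}\<close> and \<open>{x, c}\<close>; these share only
    \<open>x\<close>.\<close>
  then have "e2 = {x, d}" using i2 d' y(2) by auto
  \<comment> \<open>A pair that avoids \<open>x\<close> would have to contain \<open>y\<close>,
    \<open>c\<close> and \<open>d\<close>.\<close>
  have "x \<in> f" if f: "f \<in> E" for f
  proof (rule ccontr)
    assume "x \<notin> f"
    moreover have "f \<inter> {x, y} \<noteq> {}" "f \<inter> {x, c} \<noteq> {}" "f \<inter> {x, d} \<noteq> {}"
      using int f e0 e1(1) e2(1) ab(1) y(1) \<open>e1 = {x, c}\<close> \<open>e2 = {x, d}\<close> by blast+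
    ultimately have sub: "{y, c, d} \<subseteq> f" by auto
    have f2: "card f = 2" using pairs f by auto
    then have "finite f" using card.infinite by fastforce
    then have "card {y, c, d} \<le> 2" using card_mono[OF _ sub] f2 by simp
    then show False using \<open>d \<noteq> y\<close> \<open>d \<noteq> c\<close> \<open>c \<noteq> y\<close> by auto
  qed
  then show ?thesis by blast
qed

text \<open>
  In a star every step passes through the centre, which is therefore visited at least four times;
  with two visits to each of the other three vertices this exceeds nine.
\<close>

lemma disjoint_steps:
  assumes u: "8 \<le> length u" "length u \<le> 9" "card (set u) = 4" "\<forall>v\<in>set u. 2 \<le> count_list u v"
    and ne: "\<And>i. Suc i < length u \<Longrightarrow> u ! i \<noteq> u ! Suc i"
  shows "\<exists>i j. Suc i < length u \<and> Suc j < length u \<and> {u ! i, u ! Suc i} \<inter> {u ! j, u ! Suc j} = {}"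
proof (rule ccontr)
  assume H: "\<not> ?thesis"
  define E where "E = (\<lambda>i. {u ! i, u ! Suc i}) ` {i. Suc i < length u}"
  have "\<Union>E = set u"
  proof
    show "\<Union>E \<subseteq> set u" by (auto simp: E_def)
    show "set u \<subseteq> \<Union>E"
    proof
      fix x assume "x \<in> set u"
      then obtain i where i: "i < length u" "u ! i = x" by (metis in_set_conv_nth)
      show "x \<in> \<Union>E"
      proof (cases "Suc i < length u")
        case False
        then have "u ! Suc (i - 1) = x" "Suc (i - 1) < length u" using i u(1) by auto
        then show ?thesis unfolding E_def by blast
      qed (use i in \<open>auto simp: E_def\<close>)
    qed
  qed
  then obtain c where c: "\<forall>e\<in>E. c \<in> e"
    using intersecting_pairs_star[of E] H u(3) ne by (auto simp: E_def)
  have step: "\<exists>j\<in>{i, Suc i}. u ! j = c" if "Suc i < length u" for i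
    using c that by (auto simp: E_def)
  \<comment> \<open>The windows of positions 0-1, 2-3, 4-5 and 6-7 are disjoint and each contains a
    visit to \<open>c\<close>; all four exist because the length is at least 8.\<close>
  obtain j0 j2 j4 j6 where j: "j0 \<in> {0, Suc 0}" "j2 \<in> {2, Suc 2}" "j4 \<in> {4, Suc 4}" "j6 \<in> {6, Suc 6}"
    "u ! j0 = c" "u ! j2 = c" "u ! j4 = c" "u ! j6 = c"
    using step[of 0] step[of 2] step[of 4] step[of 6] u(1) by auto
  have "card {j0, j2, j4, j6} = 4" using j(1-4) by auto
  moreover have "{j0, j2, j4, j6} \<subseteq> {i. i < length u \<and> u ! i = c}" using j u(1) by auto
  ultimately have "4 \<le> card {i. i < length u \<and> u ! i = c}"
    using card_mono[of "{i. i < length u \<and> u ! i = c}" "{j0, j2, j4, j6}"] by simp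
  then have c4: "4 \<le> count_list u c"
    by (simp add: count_list_eq_length_filter length_filter_conv_card eq_commute)
  have "j0 < length u" using j(1) u(1) by auto
  then have cu: "c \<in> set u" using j(5) nth_mem[of j0 u] by simp
  have "length u = (\<Sum>v\<in>set u. count_list u v)" by (simp add: sum_count_set)
  also have "\<dots> = count_list u c + (\<Sum>v\<in>set u - {c}. count_list u v)"
    using cu by (simp add: sum.remove)
  also have "\<dots> \<ge> 4 + (\<Sum>v\<in>set u - {c}. 2)" using c4 u(4) by (intro add_mono sum_mono) auto
  finally show False using u(2,3) cu by (simp add: card_Diff_singleton)
qed

lemma sum_list_ge_length:
  fixes c :: nat
  shows "(\<forall>x\<in>set xs. c \<le> f x) \<Longrightarrow> c * length xs \<le> sum_list (map f xs)"
  by (induction xs) auto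

lemma quad_countable_repeated:
  assumes xs: "xs \<noteq> []" and pos: "\<forall>x\<in>set xs. 1 \<le> snd x" and total: "sum_list (map snd xs) \<le> 9"
    and rep: "\<forall>v\<in>fst ` set xs. 2 \<le> count_list (map fst xs) v"
  shows "quad_countable xs"
proof (cases "\<exists>p. (1, p, p) \<in> set (cycle_arcs xs)")
  case True
  then show ?thesis using quad_countable_loop by blast
next
  case noloop: False
  let ?V = "fst ` set xs"
  have le9: "\<forall>(x, l)\<in>set xs. l \<le> 9"
  proof -
    have "snd x \<le> sum_list (map snd xs)" if "x \<in> set xs" for x
      using that by (intro member_le_sum_list) auto
    then show ?thesis using total by fastforce
  qed
  have len9: "length xs \<le> 9" using sum_list_ge_length[of xs 1 snd] pos total by simp
  have len: "2 * card ?V \<le> length xs"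
  proof -
    have "length xs = (\<Sum>v\<in>?V. count_list (map fst xs) v)"
      using sum_count_set[of "map fst xs" ?V] by simp
    also have "\<dots> \<ge> (\<Sum>v\<in>?V. 2)" using rep by (intro sum_mono) auto
    finally show ?thesis by simp
  qed
  have "card ?V > 0" using xs by (simp add: card_gt_0_iff)
  then consider "card ?V = 1" | "card ?V = 2" | "card ?V = 3" | "card ?V = 4" using len len9 by linarith
  then show ?thesis
  proof cases
    case 1
    then obtain p where "?V = {p}" by (metis card_1_singletonE)
    then show ?thesis using quad_countableI[OF le9, of p p p p] by simp
  next
    case 2
    then obtain p s where "?V = {p, s}" by (metis card_2_iff)
    then show ?thesis using quad_countableI[OF le9, of p p s s] by simp
  next
    case 3
    \<comment> \<open>Three variables require at least six visits; if every arc had length at least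
      2, the total would be at least 12.\<close>
    have "\<exists>x\<in>set xs. snd x = 1"
    proof (rule ccontr)
      assume "\<not> ?thesis"
      then have "\<forall>x\<in>set xs. 2 \<le> snd x" using pos by force
      then have "2 * length xs \<le> 9" using sum_list_ge_length[of xs 2 snd] total by linarith
      then show False using len 3 by linarith
    qed
    then obtain p where "(p, 1) \<in> set xs" by force
    then obtain q where q: "(1, p, q) \<in> set (cycle_arcs xs)" using cycle_arcs_from by blast
    then have pq: "p \<noteq> q" "p \<in> ?V" "q \<in> ?V" using noloop cycle_arcs_vars[OF q] by auto
    have "card (?V - {p, q}) = 1" using 3 pq by (simp add: card_Diff_subset)
    then obtain s where "?V - {p, q} = {s}" by (metis card_1_singletonE)
    \<comment> \<open>With three variables the second pair degenerates to the diagonal pair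
      \<open>(s, s)\<close>.\<close>
    then have "?V = {p, q, s, s}" using pq by auto
    then show ?thesis using quad_countableI[OF le9, of p q s s] q by simp
  next
    case 4
    have len8: "8 \<le> length xs" using len 4 by simp
    \<comment> \<open>Four variables require at least eight visits, so a second arc longer than 1
      would raise the total to at least 10. A rotation moves the only possible long arc to the end,
      where \<open>butlast\<close> omits it.\<close>
    have "\<exists>as bs. xs = as @ bs \<and> (\<forall>x\<in>set (butlast (bs @ as)). snd x = 1)"
    proof (cases "\<forall>x\<in>set xs. snd x = 1")
      case True
      then show ?thesis by (intro exI[of _ "[]"] exI[of _ xs]) (auto dest: in_set_butlastD)
    next
      case False
      then obtain y where y: "y \<in> set xs" "snd y \<noteq> 1" by blast
      then obtain as bs where xs_eq: "xs = as @ y # bs" by (meson split_list)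
      have y2: "2 \<le> snd y" using y pos by force
      have "snd x = 1" if x: "x \<in> set (bs @ as)" for x
      proof (rule ccontr)
        assume "snd x \<noteq> 1"
        moreover have "1 \<le> snd x" using x pos xs_eq by auto
        ultimately have x2: "2 \<le> snd x" by linarith
        obtain cs ds where cd: "bs @ as = cs @ x # ds" using x by (meson split_list)
        have "length (cs @ ds) \<le> sum_list (map snd (cs @ ds))"
          using sum_list_ge_length[of "cs @ ds" 1 snd] pos cd xs_eq
          by (metis (no_types, lifting) Un_iff list.set_intros(2) mult_1 set_append)
        moreover have "sum_list (map snd xs) = snd y + sum_list (map snd (bs @ as))" by (simp add: xs_eq)
        moreover have "sum_list (map snd (bs @ as)) = snd x + sum_list (map snd (cs @ ds))" by (simp add: cd)
        moreover have "length xs = 1 + length (bs @ as)" by (simp add: xs_eq)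
        moreover have "length (bs @ as) = 1 + length (cs @ ds)" by (simp add: cd)
        ultimately show False using x2 y2 total len8 by linarith
      qed
      then show ?thesis
        using xs_eq by (intro exI[of _ "as @ [y]"] exI[of _ bs]) (simp add: butlast_append)
    qed
    then obtain as bs where ab: "xs = as @ bs" "\<forall>x\<in>set (butlast (bs @ as)). snd x = 1" by blast
    define ys where "ys = bs @ as"
    have ys: "length ys = length xs" "set ys = set xs" "ys \<noteq> []" using ab xs by (auto simp: ys_def)
    have one: "snd (ys ! i) = 1" if "Suc i < length ys" for i
    proof -
      have "butlast ys ! i = ys ! i" "i < length (butlast ys)" using that by (simp_all add: nth_butlast)
      then show ?thesis using ab(2) nth_mem[of i "butlast ys"] unfolding ys_def by metis
    qed
    define u where "u = map fst ys"
    have arc: "(1, u ! i, u ! Suc i) \<in> set (cycle_arcs ys)" if "Suc i < length u" for i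
      using cycle_arcs_nth[of i ys] one[of i] that by (simp add: u_def)
    have "quad_countable ys"
    proof (cases "\<exists>p. (1, p, p) \<in> set (cycle_arcs ys)")
      case True
      then show ?thesis using quad_countable_loop by blast
    next
      case False
      have cu: "count_list u v = count_list (map fst xs) v" for v
        by (simp add: u_def ys_def ab(1))
      have "\<exists>i j. Suc i < length u \<and> Suc j < length u \<and> {u ! i, u ! Suc i} \<inter> {u ! j, u ! Suc j} = {}"
      proof (rule disjoint_steps)
        show "u ! i \<noteq> u ! Suc i" if "Suc i < length u" for i using arc[OF that] False by metis
      qed (use len8 len9 ys 4 rep cu in \<open>auto simp: u_def\<close>)
      then obtain i j where ij: "Suc i < length u" "Suc j < length u"
        "{u ! i, u ! Suc i} \<inter> {u ! j, u ! Suc j} = {}" by blast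
      let ?W = "{u ! i, u ! Suc i, u ! j, u ! Suc j}"
      have "u ! i \<noteq> u ! Suc i" "u ! j \<noteq> u ! Suc j" using arc ij False by metis+
      then have "card ?W = 4" using ij(3) by auto
      moreover have "?W \<subseteq> fst ` set ys" using ij(1,2) nth_mem[of _ u] by (auto simp: u_def)
      ultimately have "fst ` set ys = ?W" using 4 ys(2) by (intro card_subset_eq[symmetric]) auto
      then show ?thesis
        using arc[OF ij(1)] arc[OF ij(2)] le9 unfolding ys(2)[symmetric]
        by (intro quad_countableI[of _ "u ! i" "u ! Suc i" "u ! j" "u ! Suc j"] disjI2)
    qed
    then show ?thesis unfolding ys_def ab(1) by (rule quad_countable_rotate)
  qed
qed

text \<open>Induction on the number of visits: summing out a variable that is visited once shortens
  the list but preserves the total length, so the bound 9 survives until every variable is visited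
  twice.\<close>

lemma quad_countable_all:
  assumes "xs \<noteq> []" "\<forall>x\<in>set xs. 1 \<le> snd x" "sum_list (map snd xs) \<le> 9"
  shows "quad_countable xs"
  using assms
proof (induction "length xs" arbitrary: xs rule: less_induct)
  case less
  show ?case
  proof (cases "(\<forall>v\<in>fst ` set xs. 2 \<le> count_list (map fst xs) v)")
    case True
    then show ?thesis using quad_countable_repeated less.prems by blast
  next
    case False
    then obtain v where v: "v \<in> fst ` set xs" "count_list (map fst xs) v < 2" by force
    then obtain l where "(v, l) \<in> set xs" by force
    then obtain as bs where xs: "xs = as @ (v, l) # bs" by (meson split_list)
    have "count_list (map fst as) v = 0" "count_list (map fst bs) v = 0" using v(2) by (auto simp: xs)
    then have nv: "v \<notin> fst ` set (bs @ as)" by (auto simp: count_list_0_iff image_iff)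
    show ?thesis
    proof (cases "bs @ as = []")
      case True
      \<comment> \<open>A single visit has no other visit to merge with, but one vertex is already
        covered by the diagonal pairs.\<close>
      then have "xs = [(v, l)]" by (simp add: xs)
      then show ?thesis using quad_countableI[of xs v v v v] less.prems by simp
    next
      case False
      \<comment> \<open>\<open>w\<close> is the predecessor of \<open>v\<close> in the cyclic
        order.\<close>
      then obtain zs w l' where zs: "bs @ as = zs @ [(w, l')]" by (metis rev_exhaust surj_pair)
      have "quad_countable ((w, l' + l) # zs)"
      proof (rule less.hyps)
        have "length xs = length (bs @ as) + 1" by (simp add: xs)
        then show "length ((w, l' + l) # zs) < length xs" unfolding zs by simp
        have "set xs = insert (v, l) (set (bs @ as))" by (auto simp: xs)
        then show "\<forall>x\<in>set ((w, l' + l) # zs). 1 \<le> snd x" using less.prems(2) unfolding zs by auto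
        have "sum_list (map snd xs) = l + sum_list (map snd (bs @ as))" by (simp add: xs)
        then show "sum_list (map snd ((w, l' + l) # zs)) \<le> 9" using less.prems(3) unfolding zs by simp
      qed simp
      then have "quad_countable ((w, l') # (v, l) # zs)"
        using nv unfolding zs
        by (intro quad_countable_cong[OF cycle_sum_eliminate]) auto
      then have "quad_countable (((v, l) # zs) @ [(w, l')])"
        using quad_countable_rotate[of "[(w, l')]" "(v, l) # zs"] by simp
      then have "quad_countable (((v, l) # bs) @ as)" by (simp add: zs)
      then show ?thesis using quad_countable_rotate[of "(v, l) # bs" as] unfolding xs by blast
    qed
  qed
qed

section \<open>Identified positions and inclusion-exclusion\<close>

lemma equalities_representatives:
  assumes "finite G" "G \<subseteq> {..<k} \<times> {..<k}"
  shows "\<exists>r. (\<forall>i<k. r i < k \<and> r (r i) = r i) \<and>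
     (\<forall>f :: nat \<Rightarrow> 'a. (\<forall>(i, j)\<in>G. f i = f j) \<longleftrightarrow> (\<forall>i<k. f (r i) = f i))"
  using assms
proof (induction G rule: finite_induct)
  case empty
  show ?case by (intro exI[of _ id]) auto
next
  case (insert x G)
  obtain i j where x: "x = (i, j)" by (cases x)
  have ij: "i < k" "j < k" using insert.prems x by auto
  obtain r where r: "\<And>i. i < k \<Longrightarrow> r i < k \<and> r (r i) = r i"
    "\<And>f :: nat \<Rightarrow> 'a. (\<forall>(i, j)\<in>G. f i = f j) \<longleftrightarrow> (\<forall>i<k. f (r i) = f i)"
    using insert by auto
  \<comment> \<open>\<open>r\<close> chooses a representative in each class of the equivalence
    relation generated by \<open>G\<close>. The new equation redirects the class of \<open>i\<close>
    to the representative of \<open>j\<close>.\<close>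
  define r' where "r' y = (if r y = r i then r j else r y)" for y
  have "r' y < k \<and> r' (r' y) = r' y" if "y < k" for y
    using r(1)[OF that] r(1)[OF ij(1)] r(1)[OF ij(2)] by (simp add: r'_def)
  moreover have "(\<forall>(i, j)\<in>insert x G. f i = f j) \<longleftrightarrow> (\<forall>i<k. f (r' i) = f i)" for f :: "nat \<Rightarrow> 'a"
  proof
    assume "\<forall>(i, j)\<in>insert x G. f i = f j"
    then have f: "f i = f j" "\<And>y. y < k \<Longrightarrow> f (r y) = f y" using r(2)[of f] x by auto
    show "\<forall>y<k. f (r' y) = f y"
    proof (intro allI impI)
      fix y assume "y < k"
      then show "f (r' y) = f y" using f(1) f(2)[of y] f(2)[OF ij(1)] f(2)[OF ij(2)] by (auto simp: r'_def)
    qed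
  next
    assume f: "\<forall>y<k. f (r' y) = f y"
    have "f (r y) = f y" if "y < k" for y
    proof -
      have "r' (r y) = r' y" using r(1)[OF that] by (simp add: r'_def)
      then show ?thesis using f r(1)[OF that] that by metis
    qed
    moreover have "f i = f j"
    proof -
      have "r' i = r' j" by (simp add: r'_def)
      then show ?thesis using f ij by metis
    qed
    ultimately show "\<forall>(i, j)\<in>insert x G. f i = f j" using r(2)[of f] x by auto
  qed
  ultimately show ?case by (intro exI[of _ r']) blast
qed

definition closed_walk :: "(nat \<times> nat) set \<Rightarrow> nat \<Rightarrow> (nat \<Rightarrow> nat) \<Rightarrow> bool" where
  "closed_walk D k f \<longleftrightarrow> (\<forall>i<k. (f i, f (Suc i mod k)) \<in> D)"

lemma card_filter: "finite A \<Longrightarrow> card {x \<in> A. P x} = (\<Sum>x\<in>A. of_bool (P x))"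
proof (induction A rule: finite_induct)
  case (insert x A)
  have "{y \<in> insert x A. P y} = (if P x then insert x {y \<in> A. P y} else {y \<in> A. P y})" by auto
  then show ?case using insert by simp
qed simp

lemma prod_of_bool:
  assumes "finite A"
  shows "(\<Prod>x\<in>A. of_bool (P x)) = (of_bool (\<forall>x\<in>A. P x) :: 'a :: comm_semiring_1)"
  using assms by (induction A rule: finite_induct) auto

text \<open>A map constrained by \<open>r\<close> is the composition of its restriction to the
  representatives with \<open>r\<close>. So the constrained closed walks are the nonzero terms, all
  equal to 1, of the pattern in which position \<open>i\<close> carries the variable
  \<open>r i\<close>.\<close>

lemma card_constrained_closed_walks:
  assumes D: "graph_relation D" and "0 < k" and r: "\<forall>i<k. r i < k \<and> r (r i) = r i"
  shows "card {f \<in> {..<k} \<rightarrow>\<^sub>E Domain D. closed_walk D k f \<and> (\<forall>i<k. f (r i) = f i)}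
     = cycle_sum D (map (\<lambda>i. (r i, 1)) [0..<k])"
proof -
  let ?xs = "map (\<lambda>i. (r i, 1)) [0..<k]"
  let ?A = "{f \<in> {..<k} \<rightarrow>\<^sub>E Domain D. closed_walk D k f \<and> (\<forall>i<k. f (r i) = f i)}"
  let ?B = "{g \<in> r ` {..<k} \<rightarrow>\<^sub>E Domain D. \<forall>i<k. (g (r i), g (r (Suc i mod k))) \<in> D}"
  have arcs: "cycle_arcs ?xs = map (\<lambda>i. (1, r i, r (Suc i mod k))) [0..<k]"
  proof (rule nth_equalityI)
    fix i assume "i < length (cycle_arcs ?xs)"
    then have i: "i < k" by (simp add: cycle_arcs_def)
    then show "cycle_arcs ?xs ! i = map (\<lambda>i. (1, r i, r (Suc i mod k))) [0..<k] ! i"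
      using \<open>0 < k\<close> nth_arcs_to[of i ?xs "fst (hd ?xs)"]
      by (cases "Suc i < k") (auto simp: cycle_arcs_def hd_map hd_conv_nth dest: not_less_less_Suc_eq)
  qed (simp add: cycle_arcs_def)
  have mono: "monomial (walks D) (cycle_arcs ?xs) g =
     of_bool (\<forall>i<k. (g (r i), g (r (Suc i mod k))) \<in> D)" for g
  proof -
    have "monomial (walks D) (cycle_arcs ?xs) g = (\<Prod>i\<leftarrow>[0..<k]. of_bool ((g (r i), g (r (Suc i mod k))) \<in> D))"
      unfolding arcs monomial_def by (simp add: o_def walks_1[OF D] del: walks.simps)
    also have "\<dots> = (\<Prod>i<k. of_bool ((g (r i), g (r (Suc i mod k))) \<in> D))"
      by (simp add: prod.distinct_set_conv_list[symmetric] atLeast0LessThan)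
    finally show ?thesis by (simp add: prod_of_bool Ball_def)
  qed
  have V: "fst ` set ?xs = r ` {..<k}" by (simp add: image_image atLeast0LessThan)
  have "cycle_sum D ?xs = card ?B"
  proof -
    from finite_Domain_graph[OF D] have fin: "finite (r ` {..<k} \<rightarrow>\<^sub>E Domain D)" by (simp add: finite_PiE)
    show ?thesis unfolding cycle_sum_def V mono card_filter[OF fin] by (rule refl)
  qed
  also have "card ?B = card ?A"
  proof (rule bij_betw_same_card[OF bij_betw_byWitness[
        where f = "\<lambda>g. restrict (g \<circ> r) {..<k}" and f' = "\<lambda>f. restrict f (r ` {..<k})"]])
    show "\<forall>g\<in>?B. restrict (restrict (g \<circ> r) {..<k}) (r ` {..<k}) = g"
    proof (intro ballI ext)
      fix g x assume "g \<in> ?B"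
      then have g: "g \<in> r ` {..<k} \<rightarrow>\<^sub>E Domain D" by simp
      show "restrict (restrict (g \<circ> r) {..<k}) (r ` {..<k}) x = g x"
      proof (cases "x \<in> r ` {..<k}")
        case True
        then obtain i where "i < k" "x = r i" by blast
        then show ?thesis using r by auto
      next
        case False
        then show ?thesis using PiE_arb[OF g False] by simp
      qed
    qed
    show "\<forall>f\<in>?A. restrict (restrict f (r ` {..<k}) \<circ> r) {..<k} = f"
    proof (intro ballI ext)
      fix f x assume "f \<in> ?A"
      then have f: "f \<in> {..<k} \<rightarrow>\<^sub>E Domain D" "\<forall>i<k. f (r i) = f i" by simp_all
      show "restrict (restrict f (r ` {..<k}) \<circ> r) {..<k} x = f x"
        using f(2) PiE_arb[OF f(1), of x] by (cases "x < k") auto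
    qed
    show "(\<lambda>g. restrict (g \<circ> r) {..<k}) ` ?B \<subseteq> ?A"
    proof (rule image_subsetI)
      fix g assume "g \<in> ?B"
      then have g: "(g (r i), g (r (Suc i mod k))) \<in> D" if "i < k" for i using that by blast
      then have "g (r i) \<in> Domain D" if "i < k" for i using that by blast
      then show "restrict (g \<circ> r) {..<k} \<in> ?A"
        using r g \<open>0 < k\<close> by (simp add: closed_walk_def)
    qed
    show "(\<lambda>f. restrict f (r ` {..<k})) ` ?A \<subseteq> ?B"
    proof (rule image_subsetI)
      fix f assume "f \<in> ?A"
      then have f: "(f i, f (Suc i mod k)) \<in> D" "f (r i) = f i" if "i < k" for i
        using that by (auto simp: closed_walk_def)
      then have "f i \<in> Domain D" if "i < k" for i using that by blast
      then have "f \<in> r ` {..<k} \<rightarrow> Domain D" using f(2) by auto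
      then show "restrict f (r ` {..<k}) \<in> ?B"
        using r f \<open>0 < k\<close> by simp
    qed
  qed
  finally show ?thesis by simp
qed

text \<open>The sum runs over sets of pairs rather than over partitions: different \<open>G\<close>
  may impose the same identifications, but the coefficients are mere signs.\<close>

lemma inj_on_inclusion_exclusion:
  fixes f :: "nat \<Rightarrow> 'a"
  shows "(of_bool (inj_on f {..<k}) :: int) =
    (\<Sum>G\<in>Pow {(i, j). i < j \<and> j < k}. (-1) ^ card G * of_bool (\<forall>(i, j)\<in>G. f i = f j))"
proof -
  let ?P = "{(i, j). i < j \<and> j < k}"
  have fin: "finite ?P" by (rule finite_subset[of _ "{..<k} \<times> {..<k}"]) auto
  have "inj_on f {..<k} \<longleftrightarrow> (\<forall>x\<in>?P. f (fst x) \<noteq> f (snd x))"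
    by (auto simp: inj_on_def) (metis linorder_neqE_nat)
  then have "(of_bool (inj_on f {..<k}) :: int) = (\<Prod>x\<in>?P. of_bool (f (fst x) \<noteq> f (snd x)))"
    using fin by (simp add: prod_of_bool)
  also have "\<dots> = (\<Prod>x\<in>?P. - of_bool (f (fst x) = f (snd x)) + 1)"
    by (intro prod.cong) auto
  also have "\<dots> = (\<Sum>G\<in>Pow ?P. (\<Prod>x\<in>G. - of_bool (f (fst x) = f (snd x))) * (\<Prod>x\<in>?P - G. 1))"
    using fin by (rule prod_add)
  also have "\<dots> = (\<Sum>G\<in>Pow ?P. (-1) ^ card G * of_bool (\<forall>(i, j)\<in>G. f i = f j))"
  proof (rule sum.cong[OF refl])
    fix G assume "G \<in> Pow ?P"
    then have "finite G" using fin finite_subset by blast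
    then show "(\<Prod>x\<in>G. - of_bool (f (fst x) = f (snd x))) * (\<Prod>x\<in>?P - G. 1) =
        ((-1) ^ card G * of_bool (\<forall>(i, j)\<in>G. f i = f j) :: int)"
      by (simp add: prod_uminus prod_of_bool case_prod_unfold)
  qed
  finally show ?thesis .
qed

definition cycle_embeddings :: "(nat \<times> nat) set \<Rightarrow> nat \<Rightarrow> (nat \<Rightarrow> nat) set" where
  "cycle_embeddings D k = {f \<in> {..<k} \<rightarrow>\<^sub>E Domain D. closed_walk D k f \<and> inj_on f {..<k}}"

text \<open>The terms are sorted by sign into \<open>ps\<close> and \<open>ns\<close> because the
  program computes with natural numbers. Neither list depends on \<open>D\<close>.\<close>

lemma card_cycle_embeddings:
  assumes "0 < k" "k \<le> 9"
  shows "\<exists>ps ns. (\<forall>fs\<in>set (ps @ ns). small_factors fs) \<and>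
    (\<forall>D. graph_relation D \<longrightarrow> int (card (cycle_embeddings D k)) =
       int (\<Sum>fs\<leftarrow>ps. quad_sum D fs) - int (\<Sum>fs\<leftarrow>ns. quad_sum D fs))"
proof -
  let ?P = "{(i, j). i < j \<and> j < k}"
  have fin: "finite ?P" by (rule finite_subset[of _ "{..<k} \<times> {..<k}"]) auto
  let ?W = "\<lambda>D. {f \<in> {..<k} \<rightarrow>\<^sub>E Domain D. closed_walk D k f}"
  let ?C = "\<lambda>D G. card {f \<in> ?W D. \<forall>(i, j)\<in>G. f i = f j}"
  have "\<exists>fs. small_factors fs \<and> (\<forall>D. graph_relation D \<longrightarrow> ?C D G = quad_sum D fs)"
    if G: "G \<in> Pow ?P" for G
  proof -
    have "finite G" "G \<subseteq> {..<k} \<times> {..<k}" using G fin by (auto intro: finite_subset)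
    then obtain r where r: "\<forall>i<k. r i < k \<and> r (r i) = r i"
      "\<And>f :: nat \<Rightarrow> nat. (\<forall>(i, j)\<in>G. f i = f j) \<longleftrightarrow> (\<forall>i<k. f (r i) = f i)"
      using equalities_representatives[of G k] by blast
    have "sum_list (map snd (map (\<lambda>i. (r i, 1::nat)) [0..<k])) = k" by (simp add: o_def sum_list_triv)
    then have "quad_countable (map (\<lambda>i. (r i, 1)) [0..<k])"
      using assms by (intro quad_countable_all) auto
    moreover have "?C D G = cycle_sum D (map (\<lambda>i. (r i, 1)) [0..<k])" if "graph_relation D" for D
      using card_constrained_closed_walks[OF that assms(1) r(1)] unfolding r(2) by (simp add: conj_assoc)
    ultimately show ?thesis unfolding quad_countable_def by auto
  qed
  then have "\<exists>F. \<forall>G\<in>Pow ?P. small_factors (F G) \<and>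
      (\<forall>D. graph_relation D \<longrightarrow> ?C D G = quad_sum D (F G))"
    by (intro bchoice ballI)
  then obtain F where "\<forall>G\<in>Pow ?P. small_factors (F G) \<and>
      (\<forall>D. graph_relation D \<longrightarrow> ?C D G = quad_sum D (F G))" ..
  then have F: "small_factors (F G)" "graph_relation D \<Longrightarrow> ?C D G = quad_sum D (F G)"
    if "G \<in> Pow ?P" for G D
    using that by blast+
  obtain Gs where Gs: "set Gs = Pow ?P" "distinct Gs" using finite_distinct_list[of "Pow ?P"] fin by auto
  define ps where "ps = map F (filter (\<lambda>G. even (card G)) Gs)"
  define ns where "ns = map F (filter (\<lambda>G. odd (card G)) Gs)"
  have "int (card (cycle_embeddings D k)) =
       int (\<Sum>fs\<leftarrow>ps. quad_sum D fs) - int (\<Sum>fs\<leftarrow>ns. quad_sum D fs)" if D: "graph_relation D" for D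
  proof -
    have finW: "finite (?W D)" using finite_Domain_graph[OF D] by (auto intro!: finite_PiE)
    have "cycle_embeddings D k = {f \<in> ?W D. inj_on f {..<k}}" by (auto simp: cycle_embeddings_def)
    then have "int (card (cycle_embeddings D k)) = (\<Sum>f\<in>?W D. of_bool (inj_on f {..<k}))"
      using finW by (simp add: Int_def)
    also have "\<dots> = (\<Sum>f\<in>?W D. \<Sum>G\<in>Pow ?P. (-1) ^ card G * of_bool (\<forall>(i, j)\<in>G. f i = f j))"
      unfolding inj_on_inclusion_exclusion ..
    also have "\<dots> = (\<Sum>G\<in>Pow ?P. \<Sum>f\<in>?W D. (-1) ^ card G * of_bool (\<forall>(i, j)\<in>G. f i = f j))"
      by (rule sum.swap)
    also have "\<dots> = (\<Sum>G\<in>Pow ?P. (-1) ^ card G * int (?C D G))"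
      using finW by (simp add: sum_distrib_left[symmetric] Int_def)
    also have "\<dots> = (\<Sum>G\<in>Pow ?P. (-1) ^ card G * int (quad_sum D (F G)))"
      by (intro sum.cong refl) (simp only: F(2)[OF _ D])
    also have "\<dots> = (\<Sum>G\<leftarrow>Gs. (-1) ^ card G * int (quad_sum D (F G)))"
      using Gs by (simp add: sum.distinct_set_conv_list[symmetric])
    also have "\<dots> = int (\<Sum>fs\<leftarrow>ps. quad_sum D fs) - int (\<Sum>fs\<leftarrow>ns. quad_sum D fs)"
      unfolding ps_def ns_def by (induction Gs) auto
    finally show ?thesis .
  qed
  moreover have "\<forall>fs\<in>set (ps @ ns). small_factors fs" using F(1) Gs(1) by (auto simp: ps_def ns_def)
  ultimately show ?thesis by blast
qed

section \<open>Cycles in the host graph\<close>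

definition adjacency :: "nat graph \<Rightarrow> (nat \<times> nat) set" where
  "adjacency H = {(x, y). {x, y} \<in> edges H}"

lemma graph_relation_adjacency:
  assumes "simple_graph H" shows "graph_relation (adjacency H)"
proof -
  have e: "x \<in> verts H \<and> y \<in> verts H \<and> x \<noteq> y" if "(x, y) \<in> adjacency H" for x y
    using assms that unfolding simple_graph_def adjacency_def by fastforce
  have "finite (adjacency H)"
    by (rule finite_subset[of _ "verts H \<times> verts H"])
      (use e assms in \<open>auto simp: simple_graph_def\<close>)
  moreover have "sym (adjacency H)" by (auto simp: sym_def adjacency_def insert_commute)
  moreover have "irrefl (adjacency H)" using e by (auto simp: irrefl_def)
  ultimately show ?thesis by (simp add: graph_relation_def)
qed

lemma cycle_graph_simple:
  assumes "3 \<le> k" shows "simple_graph (cycle_graph k)"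
proof -
  have "i \<noteq> Suc i mod k" if "i < k" for i
    using that assms by (cases "Suc i = k") auto
  then show ?thesis using assms by (auto simp: simple_graph_def cycle_graph_def card_2_iff)
qed

text \<open>A vertex on a closed walk has a neighbour, so its membership in the domain of the
  adjacency relation is automatic.\<close>

lemma embeddings_cycle_graph:
  assumes "3 \<le> k" "simple_graph H"
  shows "embeddings (cycle_graph k) H = cycle_embeddings (adjacency H) k"
proof -
  have "Domain (adjacency H) \<subseteq> verts H"
    using assms(2) by (auto simp: adjacency_def simple_graph_def)
  moreover have "(\<forall>e\<in>edges (cycle_graph k). f ` e \<in> edges H) \<longleftrightarrow> closed_walk (adjacency H) k f" for f
    by (auto simp: cycle_graph_def closed_walk_def adjacency_def)
  moreover have "f i \<in> Domain (adjacency H)" if "closed_walk (adjacency H) k f" "i < k" for f i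
    using that unfolding closed_walk_def by blast
  ultimately show ?thesis
    unfolding embeddings_def cycle_embeddings_def PiE_iff by (auto simp: cycle_graph_def)
qed

section \<open>Straight-line code and loops\<close>

fun eval :: "instr \<Rightarrow> (nat \<Rightarrow> nat) \<Rightarrow> (nat \<Rightarrow> nat)" where
  "eval (Const a c) m = m(a := c)"
| "eval (Add a b c) m = m(a := m b + m c)"
| "eval (Sub a b c) m = m(a := m b - m c)"
| "eval (Mul a b c) m = m(a := m b * m c)"
| "eval (Div a b c) m = m(a := m b div m c)"
| "eval (Load a b) m = m(a := m (m b))"
| "eval (Store a b) m = m(m a := m b)"
| "eval _ m = m"

fun straight :: "instr \<Rightarrow> bool" where
  "straight (Jump _) = False"
| "straight (JumpLess _ _ _) = False"
| "straight (Query _ _ _) = False"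
| "straight (Next _ _ _) = False"
| "straight Rewind = False"
| "straight _ = True"

fun const_of :: "instr \<Rightarrow> nat" where
  "const_of (Const a c) = c"
| "const_of _ = 0"

definition straight_code :: "nat \<Rightarrow> instr list \<Rightarrow> bool" where
  "straight_code B is \<longleftrightarrow> (\<forall>i\<in>set is. straight i \<and> const_of i \<le> B)"

text \<open>The bound \<open>M\<close> covers all intermediate states, as
  \<open>logarithmic_words\<close> speaks about every moment of a run. The time needs no argument of
  its own because the clock belongs to the state.\<close>

definition reach :: "program \<Rightarrow> host \<Rightarrow> nat \<Rightarrow> state \<Rightarrow> state \<Rightarrow> bool" where
  "reach P h M s s' \<longleftrightarrow>
     (\<exists>t. (step P h ^^ t) s = s' \<and> (\<forall>i\<le>t. \<forall>a. mem ((step P h ^^ i) s) a \<le> M))"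

definition code_at :: "program \<Rightarrow> nat \<Rightarrow> instr list \<Rightarrow> bool" where
  "code_at P n is \<longleftrightarrow> (\<exists>pre post. P = pre @ is @ post \<and> length pre = n)"

lemma code_at_append: "code_at P n (xs @ ys) \<longleftrightarrow> code_at P n xs \<and> code_at P (n + length xs) ys"
proof
  assume "code_at P n (xs @ ys)"
  then obtain pre post where "P = pre @ (xs @ ys) @ post" "length pre = n"
    unfolding code_at_def by blast
  then show "code_at P n xs \<and> code_at P (n + length xs) ys"
    unfolding code_at_def by (metis append.assoc length_append)
next
  assume a: "code_at P n xs \<and> code_at P (n + length xs) ys"
  then obtain pre post pre' post' where *: "P = pre @ xs @ post" "length pre = n"
    "P = pre' @ ys @ post'" "length pre' = n + length xs" unfolding code_at_def by blast
  then have "(pre @ xs) @ post = pre' @ (ys @ post')" by simp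
  then have "post = ys @ post'" using * by (subst (asm) append_eq_append_conv) auto
  with * show "code_at P n (xs @ ys)" unfolding code_at_def by auto
qed

lemma code_at_Cons: "code_at P n (x # ys) \<longleftrightarrow> n < length P \<and> P ! n = x \<and> code_at P (Suc n) ys"
proof -
  have "code_at P n [x] \<longleftrightarrow> n < length P \<and> P ! n = x"
    unfolding code_at_def
    by (auto simp: nth_append) (metis id_take_nth_drop append_Cons append_Nil length_take min.absorb4)
  then show ?thesis using code_at_append[of P n "[x]" ys] by simp
qed

lemma reach_refl: "\<forall>a. mem s a \<le> M \<Longrightarrow> reach P h M s s"
  unfolding reach_def by (rule exI[of _ 0]) auto

lemma reach_trans:
  assumes "reach P h M s s'" "reach P h M s' s''"
  shows "reach P h M s s''"
proof -
  obtain t1 where t1: "(step P h ^^ t1) s = s'" "\<forall>i\<le>t1. \<forall>a. mem ((step P h ^^ i) s) a \<le> M"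
    using assms(1) unfolding reach_def by blast
  obtain t2 where t2: "(step P h ^^ t2) s' = s''" "\<forall>i\<le>t2. \<forall>a. mem ((step P h ^^ i) s') a \<le> M"
    using assms(2) unfolding reach_def by blast
  have add: "(step P h ^^ (i + t1)) s = (step P h ^^ i) s'" for i
    by (simp add: funpow_add t1(1))
  have "mem ((step P h ^^ i) s) a \<le> M" if "i \<le> t2 + t1" for i a
  proof (cases "i \<le> t1")
    case False
    then have "(step P h ^^ i) s = (step P h ^^ (i - t1)) s'" using add[of "i - t1"] by simp
    then show ?thesis using t2(2) that by simp
  qed (use t1 in auto)
  then show ?thesis unfolding reach_def using add[of t2] t2(1) by blast
qed

lemma reach_mono: "reach P h M s s' \<Longrightarrow> M \<le> M' \<Longrightarrow> reach P h M' s s'"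
  unfolding reach_def using order_trans[of _ M M'] by blast

lemma reach_step:
  assumes "pc s < length P" "\<forall>a. mem s a \<le> M"
    "s' = (exec_instr h (P ! pc s) s)\<lparr>clock := clock s + instr_cost h (P ! pc s) s\<rparr>"
    "\<forall>a. mem s' a \<le> M"
  shows "reach P h M s s'"
proof -
  have "step P h s = s'" using assms unfolding step_def halted_def by simp
  moreover have "i = 0 \<or> i = 1" if "i \<le> 1" for i :: nat using that by auto
  ultimately show ?thesis unfolding reach_def using assms by (intro exI[of _ 1]) fastforce
qed

lemma straight_exec:
  assumes "straight i"
  shows "exec_instr h i s = s\<lparr>mem := eval i (mem s), pc := pc s + 1\<rparr>" "instr_cost h i s = 1"
  using assms by (cases i; simp add: set_cell_def)+

text \<open>Since \<open>2 \<le> B\<close>, squaring also dominates doubling, so the bound for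
  multiplication covers addition.\<close>

lemma eval_bound:
  assumes "\<forall>a. m a \<le> B" "2 \<le> B" "const_of i \<le> B"
  shows "eval i m a \<le> B ^ 2"
proof -
  have B: "B \<le> B ^ 2" using assms(2) by (simp add: power2_eq_square)
  have le: "m a \<le> B ^ 2" for a using assms(1) B by (meson order_trans)
  have add: "m a + m b \<le> B ^ 2" for a b
  proof -
    have "m a + m b \<le> 2 * B" using assms(1) by (simp add: add_mono mult_2)
    also have "\<dots> \<le> B ^ 2" using assms(2) by (simp add: power2_eq_square)
    finally show ?thesis .
  qed
  have mul: "m a * m b \<le> B ^ 2" for a b
    using assms(1) by (simp add: power2_eq_square mult_mono)
  have "m a div m b \<le> B ^ 2" "m a - m b \<le> B ^ 2" for a b
    using le[of a] by (meson div_le_dividend diff_le_self order_trans)+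
  then show ?thesis using le add mul assms(3) B by (cases i) auto
qed

text \<open>A single instruction at most squares the largest number in memory.\<close>

lemma straight_reach:
  assumes "code_at P (pc s) is" "straight_code B is" "\<forall>a. mem s a \<le> B" "2 \<le> B"
  shows "reach P h (B ^ (2 ^ length is)) s
     (s\<lparr>mem := fold eval is (mem s), pc := pc s + length is, clock := clock s + length is\<rparr>)"
  using assms
proof (induction "is" arbitrary: s B)
  case Nil
  then show ?case by (auto intro: reach_refl)
next
  case (Cons i "is")
  define s' where "s' = s\<lparr>mem := eval i (mem s), pc := pc s + 1, clock := clock s + 1\<rparr>"
  have B: "B \<le> B ^ 2" using Cons.prems(4) by (simp add: power2_eq_square)
  have i: "pc s < length P" "P ! pc s = i" "code_at P (pc s') is" "straight i" "const_of i \<le> B"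
    using Cons.prems unfolding code_at_Cons s'_def straight_code_def by auto
  have b': "\<forall>a. mem s' a \<le> B ^ 2"
    using eval_bound[OF Cons.prems(3,4) i(5)] by (simp add: s'_def)
  have B2: "B ^ 2 \<le> B ^ (2 ^ length (i # is))"
    using Cons.prems(4) by (intro power_increasing) auto
  have "reach P h (B ^ 2) s s'"
  proof (rule reach_step[OF i(1)])
    show "\<forall>a. mem s a \<le> B ^ 2" using Cons.prems(3) B by (meson order_trans)
    show "s' = (exec_instr h (P ! pc s) s)\<lparr>clock := clock s + instr_cost h (P ! pc s) s\<rparr>"
      using straight_exec[OF i(4)] by (simp add: i(2) s'_def)
  qed (rule b')
  then have 1: "reach P h (B ^ (2 ^ length (i # is))) s s'" using B2 by (rule reach_mono)
  have "straight_code (B ^ 2) is"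
    using Cons.prems(2) B unfolding straight_code_def by (auto intro: order_trans)
  from Cons.IH[OF i(3) this b'] Cons.prems(4) B
  have "reach P h ((B ^ 2) ^ (2 ^ length is)) s'
     (s'\<lparr>mem := fold eval is (mem s'), pc := pc s' + length is, clock := clock s' + length is\<rparr>)"
    by simp
  then have "reach P h (B ^ (2 ^ length (i # is))) s'
     (s\<lparr>mem := fold eval (i # is) (mem s), pc := pc s + length (i # is), clock := clock s + length (i # is)\<rparr>)"
    by (simp add: s'_def power_mult[symmetric])
  with 1 show ?case by (rule reach_trans)
qed

text \<open>Jump targets are absolute, hence the start address \<open>n\<close> as a parameter. Cell
  3 holds the bound and cell 4 the counter, which the body itself must increase.\<close>

definition loop_code :: "nat \<Rightarrow> instr list \<Rightarrow> instr list" where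
  "loop_code n body = [Const 4 0, JumpLess 4 3 (n + 3), Jump (n + length body + 4)] @ body @ [Jump (n + 1)]"

lemma length_loop_code [simp]: "length (loop_code n body) = length body + 4"
  by (simp add: loop_code_def)

text \<open>Squaring at every instruction would compound over the iterations. The invariant
  therefore bounds the memory by \<open>B\<close> at every loop head, where the estimate starts
  afresh, so the exponent depends on the body only. In the clock, 3 accounts for the initialisation,
  the last test and the exit jump, and 2 per iteration for the test and the jump back.\<close>

lemma loop_reach:
  assumes code: "code_at P (pc s) (loop_code (pc s) body)"
    and body: "straight_code B body" and B: "2 \<le> B" "\<forall>a. mem s a \<le> B"
    and init: "Inv 0 ((mem s)(4 := 0))"
    and step: "\<And>i m. i < n \<Longrightarrow> Inv i m \<Longrightarrow> Inv (Suc i) (fold eval body m)"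
    and inv: "\<And>i m. i \<le> n \<Longrightarrow> Inv i m \<Longrightarrow> m 4 = i \<and> m 3 = n \<and> (\<forall>a. m a \<le> B)"
  shows "\<exists>m'. Inv n m' \<and> reach P h (B ^ (2 ^ length body)) s
     (s\<lparr>mem := m', pc := pc s + length body + 4, clock := clock s + 3 + n * (length body + 2)\<rparr>)"
proof -
  define o' where "o' = pc s"
  define M where "M = B ^ (2 ^ length body)"
  have BM: "B \<le> M" unfolding M_def using B(1) by (simp add: self_le_power)
  have c: "o' < length P" "P ! o' = Const 4 0" "o' + 1 < length P" "P ! (o' + 1) = JumpLess 4 3 (o' + 3)"
    "o' + 2 < length P" "P ! (o' + 2) = Jump (o' + length body + 4)" "code_at P (o' + 3) body"
    "o' + 3 + length body < length P" "P ! (o' + 3 + length body) = Jump (o' + 1)"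
    using code unfolding o'_def[symmetric] loop_code_def
    by (simp_all add: code_at_append code_at_Cons eval_nat_numeral)
  define st where "st i m = s\<lparr>mem := m, pc := o' + 1, clock := clock s + 1 + i * (length body + 2)\<rparr>" for i m
  have start: "reach P h M s (st 0 ((mem s)(4 := 0)))"
  proof (rule reach_step)
    show "\<forall>a. mem s a \<le> M" using B(2) BM by (meson order_trans)
    then show "\<forall>a. mem (st 0 ((mem s)(4 := 0))) a \<le> M" by (simp add: st_def)
  qed (use c in \<open>auto simp: o'_def st_def set_cell_def\<close>)
  have iter: "\<exists>m'. Inv i m' \<and> reach P h M s (st i m')" if "i \<le> n" for i
    using that
  proof (induction i)
    case 0
    then show ?case using init start by blast
  next
    case (Suc i)
    then obtain m where m: "Inv i m" "reach P h M s (st i m)" by auto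
    have im: "m 4 = i" "m 3 = n" "\<forall>a. m a \<le> B" using inv[OF _ m(1)] Suc.prems by auto
    have mM: "\<forall>a. m a \<le> M" using im(3) BM by (meson order_trans)
    define s1 where "s1 = (st i m)\<lparr>pc := o' + 3, clock := clock (st i m) + 1\<rparr>"
    have r1: "reach P h M (st i m) s1"
      by (rule reach_step) (use c im mM Suc.prems in \<open>auto simp: s1_def st_def\<close>)
    define s2 where "s2 = s1\<lparr>mem := fold eval body m, pc := o' + 3 + length body, clock := clock s1 + length body\<rparr>"
    have r2: "reach P h M s1 s2"
      using straight_reach[of P s1 body B h] c(7) body im(3) B(1)
      unfolding M_def s2_def by (simp add: s1_def st_def)
    have inv': "Inv (Suc i) (fold eval body m)" using step[OF _ m(1)] Suc.prems by simp
    have mM': "\<forall>a. fold eval body m a \<le> M" using inv[OF Suc.prems inv'] BM by (meson order_trans)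
    have r3: "reach P h M s2 (st (Suc i) (fold eval body m))"
      by (rule reach_step) (use c mM' in \<open>auto simp: s2_def s1_def st_def algebra_simps\<close>)
    show ?case using inv' reach_trans[OF reach_trans[OF reach_trans[OF m(2) r1] r2] r3] by blast
  qed
  then obtain m where m: "Inv n m" "reach P h M s (st n m)" by blast
  have im: "m 4 = n" "m 3 = n" "\<forall>a. m a \<le> B" using inv[OF _ m(1)] by auto
  have mM: "\<forall>a. m a \<le> M" using im(3) BM by (meson order_trans)
  define s1 where "s1 = (st n m)\<lparr>pc := o' + 2, clock := clock (st n m) + 1\<rparr>"
  have r1: "reach P h M (st n m) s1"
    by (rule reach_step) (use c im mM in \<open>auto simp: s1_def st_def\<close>)
  have r2: "reach P h M s1 (s1\<lparr>pc := o' + length body + 4, clock := clock s1 + 1\<rparr>)"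
    by (rule reach_step) (use c mM in \<open>auto simp: s1_def st_def\<close>)
  have "s1\<lparr>pc := o' + length body + 4, clock := clock s1 + 1\<rparr> =
     s\<lparr>mem := m, pc := pc s + length body + 4, clock := clock s + 3 + n * (length body + 2)\<rparr>"
    by (simp add: s1_def st_def o'_def)
  with m(1) reach_trans[OF reach_trans[OF m(2) r1] r2] show ?thesis
    unfolding M_def by metis
qed

section \<open>Tables in memory\<close>

text \<open>
  Addresses below 16 are registers: 1 and 2 hold the constants 1 and 16, 3 the loop bound, 4 the loop
  counter, 6 to 9 the current quadruple, 10 the constant 0, 14 the length of the list of pairs, and
  5, 11, 12, 13 are scratch. The other addresses form 16 interleaved columns: 0 to 9 for the numbers
  of walks of these lengths, 10 and 11 for the positive and negative accumulators, 12 and 13 for the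
  components of the list of pairs. The row \<open>(x + y)\<^sup>2 + x\<close> determines \<open>x\<close> and \<open>y\<close>, so no bound on
  the vertices is needed to address a table.
\<close>

definition cell :: "nat \<Rightarrow> nat \<Rightarrow> nat \<Rightarrow> nat" where
  "cell l x y = 16 * ((x + y) ^ 2 + x + 1) + l"

text \<open>With s = x + y the value lies between s^2 and (s + 1)^2 - 1, so it determines s and then
  x.\<close>

lemma square_add_inj:
  fixes x y x' y' :: nat
  assumes "(x + y) ^ 2 + x = (x' + y') ^ 2 + x'"
  shows "x = x' \<and> y = y'"
proof -
  have lt: "(a + b) ^ 2 + a < (c + d) ^ 2 + c" if "a + b < c + d" for a b c d :: nat
  proof -
    have "(a + b) ^ 2 + a < (a + b + 1) ^ 2" by (simp add: power2_eq_square)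
    also have "\<dots> \<le> (c + d) ^ 2" using that by (intro power_mono) auto
    finally show ?thesis by simp
  qed
  have "x + y = x' + y'" using lt[of x y x' y'] lt[of x' y' x y] assms by linarith
  then show ?thesis using assms by simp
qed

lemma cell_mod: "l < 16 \<Longrightarrow> cell l x y mod 16 = l"
  unfolding cell_def mod_mult_self4 by simp

lemma cell_div: "l < 16 \<Longrightarrow> cell l x y div 16 = (x + y) ^ 2 + x + 1"
  unfolding cell_def by (subst div_mult_self4) simp_all

lemma cell_inj:
  assumes "l < 16" "l' < 16"
  shows "cell l x y = cell l' x' y' \<longleftrightarrow> l = l' \<and> x = x' \<and> y = y'"
proof
  assume eq: "cell l x y = cell l' x' y'"
  then show "l = l' \<and> x = x' \<and> y = y'"
    using square_add_inj[of x y x' y'] assms cell_mod[of l x y] cell_mod[of l' x' y']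
      cell_div[of l x y] cell_div[of l' x' y'] by simp
qed auto

lemma cell_ge: "16 \<le> cell l x y" unfolding cell_def by simp

lemma cell_neq_reg: "r < 16 \<Longrightarrow> cell l x y \<noteq> r" "r < 16 \<Longrightarrow> r \<noteq> cell l x y"
  using cell_ge[of l x y] by auto

section \<open>Code for a single update of a table entry\<close>

type_synonym factor = "nat \<times> nat \<times> nat"
text \<open>An update consists of a target cell and a list of source cells; the product of the
  sources is added to the target. Cells are given by a column and two coordinates of the current
  quadruple.\<close>

type_synonym upd = "factor \<times> factor list"

fun addr_code :: "factor \<Rightarrow> instr list" where
  "addr_code (l, i, j) = [Add 12 (6 + i) (6 + j), Mul 12 12 12, Add 12 12 (6 + i), Add 12 12 1,
     Mul 12 12 2, Const 13 l, Add 12 12 13]"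

fun addr :: "factor \<Rightarrow> (nat \<Rightarrow> nat) \<Rightarrow> nat" where
  "addr (l, i, j) v = cell l (v i) (v j)"

definition regs :: "(nat \<Rightarrow> nat) \<Rightarrow> nat \<Rightarrow> nat" where
  "regs m i = m (6 + i)"

lemma addr_code_eval:
  assumes "m 1 = 1" "m 2 = 16" "i < 5" "j < 5"
  shows "fold eval (addr_code (l, i, j)) m = m(13 := l, 12 := addr (l, i, j) (regs m))"
  using assms by (auto simp: fun_eq_iff cell_def power2_eq_square algebra_simps regs_def)

definition factor_code :: "factor \<Rightarrow> instr list" where
  "factor_code f = addr_code f @ [Load 13 12, Mul 11 11 13]"

text \<open>The closing constants reset the scratch registers, which are 0 on entry, so that the
  code acts on the whole memory exactly as \<open>update\<close> does.\<close>

definition update_code :: "upd \<Rightarrow> instr list" where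
  "update_code u = [Const 11 1] @ concat (map factor_code (snd u)) @ addr_code (fst u) @
     [Load 13 12, Add 11 11 13, Store 12 11, Const 11 0, Const 12 0, Const 13 0]"

text \<open>Columns 12 and 13 hold the list of pairs and are out of range, so updates neither read
  nor change the list.\<close>

definition small_index :: "factor \<Rightarrow> bool" where
  "small_index f \<longleftrightarrow> fst f < 12 \<and> fst (snd f) < 5 \<and> snd (snd f) < 5"

definition product :: "(nat \<Rightarrow> nat) \<Rightarrow> factor list \<Rightarrow> (nat \<Rightarrow> nat) \<Rightarrow> nat" where
  "product m fs v = (\<Prod>f\<leftarrow>fs. m (addr f v))"

lemma addr_ge: "16 \<le> addr f v"
  by (cases f) (simp add: cell_ge)

lemma addr_neq: "r < 16 \<Longrightarrow> addr f v \<noteq> r"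
  using addr_ge[of f v] by auto

lemma regs_upd: "r < 6 \<or> 10 < r \<Longrightarrow> i < 5 \<Longrightarrow> regs (m(r := x)) i = regs m i"
  by (auto simp: regs_def)

lemma addr_cong: "small_index f \<Longrightarrow> (\<And>i. i < 5 \<Longrightarrow> v i = w i) \<Longrightarrow> addr f v = addr f w"
  by (cases f) (simp add: small_index_def)

lemma factor_code_eval:
  assumes "m 1 = 1" "m 2 = 16" "small_index f"
  shows "fold eval (factor_code f) m =
     m(13 := m (addr f (regs m)), 12 := addr f (regs m), 11 := m 11 * m (addr f (regs m)))"
proof -
  obtain l i j where f: "f = (l, i, j)" by (cases f)
  have "fold eval (addr_code f) m = m(13 := l, 12 := addr f (regs m))"
    using addr_code_eval[of m i j l] assms by (simp add: f small_index_def)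
  then show ?thesis
    using addr_ge[of f "regs m"] by (auto simp: factor_code_def fun_eq_iff)
qed

lemma factors_code_eval:
  assumes "m 1 = 1" "m 2 = 16" "\<forall>f\<in>set fs. small_index f"
  shows "\<exists>x y. fold eval (concat (map factor_code fs)) m =
     m(13 := x, 12 := y, 11 := m 11 * product m fs (regs m))"
  using assms
proof (induction fs arbitrary: m)
  case Nil
  show ?case by (intro exI[of _ "m 13"] exI[of _ "m 12"]) (auto simp: product_def fun_eq_iff)
next
  case (Cons f fs)
  define m' where "m' = m(13 := m (addr f (regs m)), 12 := addr f (regs m), 11 := m 11 * m (addr f (regs m)))"
  have m': "fold eval (factor_code f) m = m'"
    using factor_code_eval Cons.prems unfolding m'_def by simp
  have a: "addr g (regs m') = addr g (regs m)" if "small_index g" for g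
    using that by (rule addr_cong) (auto simp: m'_def regs_upd)
  have "m' (addr g (regs m)) = m (addr g (regs m))" for g
    using addr_neq[of _ g] by (simp add: m'_def)
  then have p: "product m' fs (regs m') = product m fs (regs m)"
    using a Cons.prems(3) unfolding product_def by (intro arg_cong[of _ _ prod_list] map_cong) auto
  have "m' 1 = 1" "m' 2 = 16" using Cons.prems by (auto simp: m'_def)
  then have "\<exists>x y. fold eval (concat (map factor_code fs)) m' =
     m'(13 := x, 12 := y, 11 := m' 11 * product m' fs (regs m'))"
    using Cons.prems(3) by (intro Cons.IH) simp_all
  then obtain x y where "fold eval (concat (map factor_code fs)) m' =
     m'(13 := x, 12 := y, 11 := m' 11 * product m' fs (regs m'))"
    by blast
  then show ?case unfolding p
    by (intro exI[of _ x] exI[of _ y]) (auto simp: m' m'_def fun_eq_iff product_def)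
qed

definition update :: "upd \<Rightarrow> (nat \<Rightarrow> nat) \<Rightarrow> (nat \<Rightarrow> nat)" where
  "update u m = m(addr (fst u) (regs m) := m (addr (fst u) (regs m)) + product m (snd u) (regs m))"

definition valid_upd :: "upd \<Rightarrow> bool" where
  "valid_upd u \<longleftrightarrow> small_index (fst u) \<and> (\<forall>f\<in>set (snd u). small_index f)"

lemma update_code_eval:
  assumes m: "m 1 = 1" "m 2 = 16" "m 11 = 0" "m 12 = 0" "m 13 = 0" and "valid_upd u"
  shows "fold eval (update_code u) m = update u m"
proof -
  have u: "small_index (fst u)" "\<forall>f\<in>set (snd u). small_index f" using assms by (auto simp: valid_upd_def)
  obtain l i j where f: "fst u = (l, i, j)" by (cases "fst u")
  define m1 where "m1 = m(11 := 1)"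
  obtain x y where xy: "fold eval (concat (map factor_code (snd u))) m1 =
     m1(13 := x, 12 := y, 11 := m1 11 * product m1 (snd u) (regs m1))"
    using factors_code_eval[of m1 "snd u"] m u by (auto simp: m1_def)
  have a: "addr g (regs m1) = addr g (regs m)" if "small_index g" for g
    using that by (rule addr_cong) (auto simp: m1_def regs_upd)
  have "m1 (addr g (regs m)) = m (addr g (regs m))" for g
    using addr_neq[of _ g] by (simp add: m1_def)
  then have p: "product m1 (snd u) (regs m1) = product m (snd u) (regs m)"
    using a u(2) unfolding product_def by (intro arg_cong[of _ _ prod_list] map_cong) auto
  define m2 where "m2 = m(13 := x, 12 := y, 11 := product m (snd u) (regs m))"
  have m2: "fold eval (concat (map factor_code (snd u))) m1 = m2"
    unfolding xy p by (auto simp: m1_def m2_def fun_eq_iff)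
  have "addr (fst u) (regs m2) = addr (fst u) (regs m)"
    using u(1) by (rule addr_cong) (auto simp: m2_def regs_upd)
  then have "fold eval (addr_code (fst u)) m2 = m2(13 := l, 12 := addr (fst u) (regs m))"
    using addr_code_eval[of m2 i j l] u m by (simp add: f small_index_def m2_def)
  then have "fold eval (update_code u) m = fold eval [Load 13 12, Add 11 11 13, Store 12 11, Const 11 0, Const 12 0, Const 13 0]
     (m2(13 := l, 12 := addr (fst u) (regs m)))"
    using m2 by (simp add: update_code_def m1_def)
  also have "\<dots> = update u m"
    using addr_ge[of "fst u" "regs m"] m(3-5) by (auto simp: update_def m2_def fun_eq_iff)
  finally show ?thesis .
qed

section \<open>Passes over all pairs of list entries\<close>

text \<open>As no source of a pass is also a target, its updates do not affect each other.\<close>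

definition valid_pass :: "upd list \<Rightarrow> bool" where
  "valid_pass us \<longleftrightarrow> (\<forall>u\<in>set us. valid_upd u) \<and>
     (\<forall>u\<in>set us. \<forall>f\<in>set (snd u). \<forall>u'\<in>set us. fst f \<noteq> fst (fst u'))"

definition increment :: "upd list \<Rightarrow> (nat \<Rightarrow> nat) \<Rightarrow> (nat \<Rightarrow> nat) \<Rightarrow> nat \<Rightarrow> nat" where
  "increment us m v a = (\<Sum>u\<leftarrow>us. of_bool (addr (fst u) v = a) * product m (snd u) v)"

lemma addr_mod: "small_index f \<Longrightarrow> addr f v mod 16 = fst f"
  by (cases f) (simp add: small_index_def cell_mod)

lemma update_reg: "r < 16 \<Longrightarrow> update u m r = m r"
  using addr_neq[of r "fst u" "regs m"] by (simp add: update_def)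

lemma increment_reg: "a < 16 \<Longrightarrow> increment us m v a = 0"
proof -
  assume "a < 16"
  then have "addr f v \<noteq> a" for f using addr_neq by blast
  then show ?thesis by (simp add: increment_def)
qed

lemma product_cong:
  assumes "\<And>f. f \<in> set fs \<Longrightarrow> m (addr f v) = m' (addr f v')"
  shows "product m fs v = product m' fs v'"
  unfolding product_def using assms by (intro arg_cong[of _ _ prod_list] map_cong) auto

text \<open>Sources lie outside the target columns, so amounts already added to the targets do not
  alter later increments. Hence all increments of a pass can be computed from its initial
  memory.\<close>

lemma increment_cong:
  assumes us: "valid_pass us"
    and m: "\<And>a. a \<ge> 16 \<Longrightarrow> (\<forall>u\<in>set us. a mod 16 \<noteq> fst (fst u)) \<Longrightarrow> m a = m' a"
    and v: "\<And>i. i < 5 \<Longrightarrow> v i = v' i"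
  shows "increment us m v a = increment us m' v' a"
proof -
  have "addr (fst u) v = addr (fst u) v' \<and> product m (snd u) v = product m' (snd u) v'" if u: "u \<in> set us" for u
  proof
    show "addr (fst u) v = addr (fst u) v'"
      using us u v unfolding valid_pass_def valid_upd_def by (auto intro: addr_cong)
    show "product m (snd u) v = product m' (snd u) v'"
    proof (rule product_cong)
      fix f assume f: "f \<in> set (snd u)"
      then have fi: "small_index f" using us u unfolding valid_pass_def valid_upd_def by auto
      then have "addr f v = addr f v'" using v by (auto intro: addr_cong)
      moreover have "m (addr f v) = m' (addr f v)"
        using us u f addr_mod[OF fi] unfolding valid_pass_def by (intro m addr_ge) auto
      ultimately show "m (addr f v) = m' (addr f v')" by simp
    qed
  qed
  then show ?thesis unfolding increment_def by (intro arg_cong[of _ _ sum_list] map_cong) auto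
qed

lemma fold_update:
  assumes "valid_pass us"
  shows "fold update us m = (\<lambda>a. m a + increment us m (regs m) a)"
  using assms
proof (induction us arbitrary: m)
  case Nil
  then show ?case by (simp add: increment_def)
next
  case (Cons u us)
  have us: "valid_pass us" using Cons.prems unfolding valid_pass_def by auto
  have r: "regs (update u m) i = regs m i" if "i < 5" for i
    using that by (simp add: regs_def update_reg)
  have u: "small_index (fst u)" using Cons.prems unfolding valid_pass_def valid_upd_def by auto
  have inc: "increment us (update u m) (regs (update u m)) a = increment us m (regs m) a" for a
  proof -
    have "update u m b = m b" if "b mod 16 \<noteq> fst (fst u)" for b
      using that addr_mod[OF u, of "regs m"] by (auto simp: update_def)
    note unchanged = this
    have ac: "addr f (regs (update u m)) = addr f (regs m)" if "small_index f" for f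
      using that r by (rule addr_cong)
    have "product (update u m) (snd w) (regs (update u m)) = product m (snd w) (regs m) \<and>
       addr (fst w) (regs (update u m)) = addr (fst w) (regs m)" if w: "w \<in> set us" for w
    proof
      show "product (update u m) (snd w) (regs (update u m)) = product m (snd w) (regs m)"
      proof (rule product_cong)
        fix f assume f: "f \<in> set (snd w)"
        then have fi: "small_index f" "fst f \<noteq> fst (fst u)"
          using w Cons.prems unfolding valid_pass_def valid_upd_def by auto
        show "update u m (addr f (regs (update u m))) = m (addr f (regs m))"
          unfolding ac[OF fi(1)] using fi by (intro unchanged) (simp add: addr_mod)
      qed
      show "addr (fst w) (regs (update u m)) = addr (fst w) (regs m)"
        using w Cons.prems unfolding valid_pass_def valid_upd_def by (intro ac) auto
    qed
    then show ?thesis unfolding increment_def by (intro arg_cong[of _ _ sum_list] map_cong) auto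
  qed
  show ?case
    unfolding fold_Cons o_def Cons.IH[OF us] inc
    by (auto simp: fun_eq_iff update_def increment_def)
qed

definition updates_code :: "upd list \<Rightarrow> instr list" where
  "updates_code us = concat (map update_code us)"

lemma updates_code_eval:
  assumes "valid_pass us" and m: "m 1 = 1" "m 2 = 16" "m 11 = 0" "m 12 = 0" "m 13 = 0"
  shows "fold eval (updates_code us) m = (\<lambda>a. m a + increment us m (regs m) a)"
proof -
  have "\<forall>u\<in>set us. valid_upd u" using assms(1) by (simp add: valid_pass_def)
  then have "fold eval (updates_code us) m = fold update us m"
    using m
  proof (induction us arbitrary: m)
    case (Cons u us)
    then show ?case by (simp add: updates_code_def update_code_eval update_reg)
  qed (simp add: updates_code_def)
  then show ?thesis using fold_update[OF assms(1)] by simp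
qed

text \<open>Entry \<open>i\<close> of the list occupies row \<open>i + 1\<close> of columns 12 and
  13, because row 0 consists of the registers. This is the origin of the offsets 28 = 16 + 12 and 29
  = 16 + 13.\<close>

definition fetch_pair_code :: "nat \<Rightarrow> nat \<Rightarrow> instr list" where
  "fetch_pair_code a b =
     [Add 12 5 1, Mul 12 12 2, Const 13 12, Add 12 12 13, Load a 12, Add 12 12 1, Load b 12]"

text \<open>A single counter replaces two nested loops: its quotient and its remainder modulo the
  length of the list are the two indices. The remainder is computed by multiplying back and
  subtracting.\<close>

definition fetch_code :: "instr list" where
  "fetch_code = [Div 5 4 14] @ fetch_pair_code 6 7 @ [Mul 5 5 14, Sub 5 4 5] @
     fetch_pair_code 8 9 @ [Const 12 0, Const 13 0]"

lemma fetch_pair_code_eval: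
  assumes "m 1 = 1" "m 2 = 16" "5 < a" "a < b" "b < 12"
  shows "fold eval (fetch_pair_code a b) m =
     m(13 := 12, 12 := 16 * m 5 + 29, a := m (16 * m 5 + 28), b := m (16 * m 5 + 29))"
  using assms by (auto simp: fetch_pair_code_def fun_eq_iff algebra_simps)

lemma fetch_code_eval:
  assumes "m 1 = 1" "m 2 = 16" "m 12 = 0" "m 13 = 0"
  defines "i \<equiv> m 4 div m 14" and "j \<equiv> m 4 mod m 14"
  shows "fold eval fetch_code m = m(5 := j, 6 := m (16 * i + 28), 7 := m (16 * i + 29),
     8 := m (16 * j + 28), 9 := m (16 * j + 29))"
proof -
  have "fold eval fetch_code m = m(5 := m 4 - i * m 14, 6 := m (16 * i + 28), 7 := m (16 * i + 29),
     8 := m (16 * (m 4 - i * m 14) + 28), 9 := m (16 * (m 4 - i * m 14) + 29))"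
    using assms(1-4) unfolding i_def
    by (simp add: fetch_code_def fetch_pair_code_eval fun_eq_iff)
  then show ?thesis by (simp add: i_def j_def minus_div_mult_eq_mod)
qed

definition pass_body :: "upd list \<Rightarrow> instr list" where
  "pass_body us = fetch_code @ updates_code us @ [Add 4 4 1]"

definition stored :: "(nat \<times> nat) list \<Rightarrow> (nat \<Rightarrow> nat) \<Rightarrow> bool" where
  "stored ds m \<longleftrightarrow> m 1 = 1 \<and> m 2 = 16 \<and> m 14 = length ds \<and>
     m 10 = 0 \<and> m 11 = 0 \<and> m 12 = 0 \<and> m 13 = 0 \<and>
     (\<forall>i<length ds. m (16 * i + 28) = fst (ds ! i) \<and> m (16 * i + 29) = snd (ds ! i))"

definition quad_at :: "(nat \<times> nat) list \<Rightarrow> nat \<Rightarrow> nat \<Rightarrow> nat" where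
  "quad_at ds i = quad (ds ! (i div length ds)) (ds ! (i mod length ds))"

lemma less_5: "(i::nat) < 5 \<longleftrightarrow> i = 0 \<or> i = Suc 0 \<or> i = 2 \<or> i = 3 \<or> i = 4" by auto

lemma pass_body_eval:
  assumes us: "valid_pass us" and m: "stored ds m" and lt: "m 4 < length ds * length ds"
  shows "fold eval (pass_body us) m =
    (\<lambda>a. (m(4 := Suc (m 4), 5 := m 4 mod length ds, 6 := quad_at ds (m 4) 0, 7 := quad_at ds (m 4) 1,
      8 := quad_at ds (m 4) 2, 9 := quad_at ds (m 4) 3)) a + increment us m (quad_at ds (m 4)) a)"
proof -
  let ?n = "length ds"
  define m1 where "m1 = m(5 := m 4 mod ?n, 6 := quad_at ds (m 4) 0, 7 := quad_at ds (m 4) 1,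
      8 := quad_at ds (m 4) 2, 9 := quad_at ds (m 4) 3)"
  have pos: "?n > 0" using lt by (cases ds) auto
  have ij: "m 4 div ?n < ?n" "m 4 mod ?n < ?n"
    using lt pos by (auto simp: less_mult_imp_div_less)
  have f: "fold eval fetch_code m = m1"
    using fetch_code_eval[of m] m ij unfolding stored_def m1_def quad_at_def
    by (simp add: numeral_eq_Suc[of "num.One"])
  have r: "regs m1 t = quad_at ds (m 4) t" if "t < 5" for t
    using that m unfolding less_5 by (auto simp: regs_def m1_def quad_at_def stored_def)
  have "fold eval (updates_code us) m1 = (\<lambda>a. m1 a + increment us m1 (regs m1) a)"
    by (rule updates_code_eval[OF us]) (use m in \<open>auto simp: m1_def stored_def\<close>)
  also have "increment us m1 (regs m1) = increment us m (quad_at ds (m 4))"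
    by (rule ext, rule increment_cong[OF us]) (simp_all add: r, simp add: m1_def)
  finally have "fold eval (updates_code us) m1 = (\<lambda>a. m1 a + increment us m (quad_at ds (m 4)) a)" .
  then show ?thesis
    using m by (auto simp: pass_body_def f m1_def fun_eq_iff increment_reg stored_def)
qed

lemma increment_bound:
  assumes "\<forall>a. m a \<le> B" "\<forall>u\<in>set us. length (snd u) \<le> F" "1 \<le> B"
  shows "increment us m v a \<le> length us * B ^ F"
proof -
  have pr: "product m fs v \<le> B ^ length fs" for fs
    unfolding product_def using assms(1) by (induction fs) (auto intro: mult_mono)
  have pu: "product m (snd u) v \<le> B ^ F" if "u \<in> set us" for u
    using pr[of "snd u"] assms(2,3) that by (meson order_trans power_increasing)
  have "increment us m v a \<le> (\<Sum>u\<leftarrow>us. B ^ F)"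
    unfolding increment_def by (rule sum_list_mono) (use pu in auto)
  then show ?thesis by (simp add: sum_list_triv)
qed

lemma straight_code_mono: "straight_code B is \<Longrightarrow> B \<le> B' \<Longrightarrow> straight_code B' is"
  unfolding straight_code_def by (auto intro: order_trans)

lemma straight_code_append [simp]:
  "straight_code B (xs @ ys) \<longleftrightarrow> straight_code B xs \<and> straight_code B ys"
  by (auto simp: straight_code_def)

lemma straight_code_simps [simp]:
  "straight_code B []" "straight_code B (x # xs) \<longleftrightarrow> straight x \<and> const_of x \<le> B \<and> straight_code B xs"
  by (auto simp: straight_code_def)

lemma straight_addr_code: "small_index f \<Longrightarrow> straight_code 16 (addr_code f)"
  by (cases f) (simp add: small_index_def)

lemma straight_update_code:
  assumes "valid_upd u" shows "straight_code 16 (update_code u)"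
proof -
  have "straight_code 16 (concat (map factor_code fs))" if "\<forall>f\<in>set fs. small_index f" for fs
    using that by (induction fs) (auto simp: factor_code_def straight_addr_code)
  then show ?thesis using assms by (simp add: update_code_def valid_upd_def straight_addr_code)
qed

lemma straight_pass_body:
  assumes "valid_pass us" shows "straight_code 16 (pass_body us)"
proof -
  have "straight_code 16 (updates_code us)" if "\<forall>u\<in>set us. valid_upd u" for us
    using that by (induction us) (auto simp: updates_code_def straight_update_code)
  then show ?thesis using assms
    by (simp add: pass_body_def fetch_code_def fetch_pair_code_def valid_pass_def)
qed

lemma increment_zero:
  assumes "valid_pass us" "\<forall>u\<in>set us. a mod 16 \<noteq> fst (fst u)"
  shows "increment us m v a = 0"
proof -
  have "addr (fst u) v \<noteq> a" if "u \<in> set us" for u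
    using assms that addr_mod[of "fst u" v] unfolding valid_pass_def valid_upd_def by auto
  then show ?thesis unfolding increment_def by simp
qed

lemma increment_array:
  assumes "valid_pass us" "12 \<le> a mod 16"
  shows "increment us m v a = 0"
  using assms by (intro increment_zero) (auto simp: valid_pass_def valid_upd_def small_index_def)

text \<open>All natural numbers \<open>x\<close> and \<open>y\<close> are included, not only
  vertices, so that \<open>T\<close> describes these columns completely. Cells never written hold 0,
  as the numbers of walks do there.\<close>

definition tables :: "(nat \<Rightarrow> nat \<Rightarrow> nat \<Rightarrow> nat) \<Rightarrow> (nat \<Rightarrow> nat) \<Rightarrow> bool" where
  "tables T m \<longleftrightarrow> (\<forall>l<12. \<forall>x y. m (cell l x y) = T l x y)"

text \<open>The products refer to the old \<open>T\<close>, since no target of a valid pass is among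
  its sources.\<close>

definition pass ::
  "(nat \<times> nat) set \<Rightarrow> upd list \<Rightarrow> (nat \<Rightarrow> nat \<Rightarrow> nat \<Rightarrow> nat) \<Rightarrow> nat \<Rightarrow> nat \<Rightarrow> nat \<Rightarrow> nat" where
  "pass S us T l x y = T l x y + (\<Sum>p\<in>S. \<Sum>q\<in>S. \<Sum>u\<leftarrow>us.
     of_bool (fst (fst u) = l \<and> quad p q (fst (snd (fst u))) = x \<and> quad p q (snd (snd (fst u))) = y) *
     monomial T (snd u) (quad p q))"

lemma sum_div_mod:
  fixes f :: "nat \<Rightarrow> nat \<Rightarrow> nat"
  shows "(\<Sum>i<n * n. f (i div n) (i mod n)) = (\<Sum>i<n. \<Sum>j<n. f i j)"
proof -
  have "(\<Sum>i<n * n. f (i div n) (i mod n)) = (\<Sum>i<n. \<Sum>t\<in>{i * n..<i * n + n}. f (t div n) (t mod n))"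
    by (rule sum.nat_group[symmetric])
  also have "\<dots> = (\<Sum>i<n. \<Sum>j<n. f i j)"
  proof (rule sum.cong[OF refl])
    fix i assume "i \<in> {..<n}"
    show "(\<Sum>t\<in>{i * n..<i * n + n}. f (t div n) (t mod n)) = (\<Sum>j<n. f i j)"
      unfolding sum.atLeastLessThan_shift_0[of _ "i * n"]
      by (auto simp: atLeast0LessThan add.commute[of "i * n"] intro!: sum.cong)
  qed
  finally show ?thesis .
qed

lemma sum_quad_at:
  fixes F :: "(nat \<Rightarrow> nat) \<Rightarrow> nat"
  assumes "distinct ds"
  shows "(\<Sum>i<length ds * length ds. F (quad_at ds i)) = (\<Sum>p\<in>set ds. \<Sum>q\<in>set ds. F (quad p q))"
proof -
  have nth: "(\<Sum>i<length ds. g (ds ! i)) = sum g (set ds)" for g :: "nat \<times> nat \<Rightarrow> nat"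
    using sum.reindex_bij_betw[OF bij_betw_nth[OF assms refl refl]] .
  show ?thesis unfolding quad_at_def
    using sum_div_mod[of "\<lambda>i j. F (quad (ds ! i) (ds ! j))" "length ds"]
      nth[of "\<lambda>p. \<Sum>j<length ds. F (quad p (ds ! j))"] nth[of "\<lambda>q. F (quad _ q)"] by simp
qed

lemma increment_tables:
  assumes us: "valid_pass us" and T: "tables T m" and l: "l < 12"
  shows "increment us m v (cell l x y) = (\<Sum>u\<leftarrow>us.
     of_bool (fst (fst u) = l \<and> v (fst (snd (fst u))) = x \<and> v (snd (snd (fst u))) = y) * monomial T (snd u) v)"
proof -
  have pr: "product m fs v = monomial T fs v" if "\<forall>f\<in>set fs. small_index f" for fs
    using that T unfolding product_def monomial_def
    by (intro arg_cong[of _ _ prod_list] map_cong) (auto simp: tables_def small_index_def)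
  have "(addr (fst u) v = cell l x y) =
      (fst (fst u) = l \<and> v (fst (snd (fst u))) = x \<and> v (snd (snd (fst u))) = y)" if "small_index (fst u)" for u :: upd
    using that l by (cases u) (auto simp: small_index_def cell_inj)
  then show ?thesis
    unfolding increment_def using us pr
    by (intro arg_cong[of _ _ sum_list] map_cong) (auto simp: valid_pass_def valid_upd_def)
qed

text \<open>Every increment can be evaluated in the initial memory, whose cells are at most
  \<open>B\<close>, so the cells grow only additively during the loop; \<open>B'\<close> allows for
  the total of all increments.\<close>

lemma pass_reach:
  assumes us: "valid_pass us" and F: "\<forall>u\<in>set us. length (snd u) \<le> F"
    and code: "code_at P (pc s) (loop_code (pc s) (pass_body us))"
    and s: "stored ds (mem s)" "mem s 3 = length ds * length ds" "tables T (mem s)" "\<forall>a. mem s a \<le> B"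
    and ds: "distinct ds" and B: "16 \<le> B" "length ds * length ds \<le> B"
    and B': "B + length ds * length ds * (length us * B ^ F) \<le> B'"
  shows "\<exists>m'. stored ds m' \<and> m' 3 = length ds * length ds \<and> tables (pass (set ds) us T) m' \<and>
     (\<forall>a. m' a \<le> B') \<and> reach P h (B' ^ (2 ^ length (pass_body us))) s
     (s\<lparr>mem := m', pc := pc s + length (pass_body us) + 4,
        clock := clock s + 3 + length ds * length ds * (length (pass_body us) + 2)\<rparr>)"
proof -
  define n where "n = length ds"
  define m0 where "m0 = mem s"
  define Inv where "Inv i m \<longleftrightarrow> stored ds m \<and> m 3 = n * n \<and> m 4 = i \<and> (\<forall>a<16. m a \<le> B) \<and>
     (\<forall>a\<ge>16. m a = m0 a + (\<Sum>t<i. increment us m0 (quad_at ds t) a))" for i m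
  have BB': "B \<le> B'" using B' by simp
  have arr: "increment us m v (16 * i + 28) = 0" "increment us m v (16 * i + 29) = 0" for m v i
    using us by (auto intro!: increment_array simp: mod_mult_self4)
  have init: "Inv 0 ((mem s)(4 := 0))"
    using s unfolding Inv_def stored_def m0_def n_def by auto
  have bound: "m a \<le> B'" if "Inv i m" "i \<le> n * n" for i m a
  proof (cases "a < 16")
    case True
    then show ?thesis using that BB' unfolding Inv_def by (meson order_trans)
  next
    case False
    have "increment us m0 v a \<le> length us * B ^ F" for v
      using increment_bound[of m0 B us F v a] s(4) F B(1) unfolding m0_def by simp
    then have "(\<Sum>t<i. increment us m0 (quad_at ds t) a) \<le> (\<Sum>t<i. length us * B ^ F)"
      by (intro sum_mono)
    also have "\<dots> \<le> n * n * (length us * B ^ F)" using that(2) by (simp only: sum_constant card_lessThan of_nat_id mult_le_mono1)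
    finally have "m0 a + (\<Sum>t<i. increment us m0 (quad_at ds t) a) \<le> B + n * n * (length us * B ^ F)"
      using s(4) unfolding m0_def[symmetric] by (intro add_mono) auto
    moreover have "m a = m0 a + (\<Sum>t<i. increment us m0 (quad_at ds t) a)"
      using that(1) False unfolding Inv_def by simp
    ultimately show ?thesis using B' unfolding n_def by linarith
  qed
  have step: "Inv (Suc i) (fold eval (pass_body us) m)" if i: "i < n * n" and m: "Inv i m" for i m
  proof -
    have st: "stored ds m" "m 3 = n * n" "m 4 = i" "\<forall>a<16. m a \<le> B"
      "\<And>a. a \<ge> 16 \<Longrightarrow> m a = m0 a + (\<Sum>t<i. increment us m0 (quad_at ds t) a)"
      using m unfolding Inv_def by blast+
    have inc: "increment us m v a = increment us m0 v a" for v a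
      using us
    proof (rule increment_cong)
      fix a assume "16 \<le> a" "\<forall>u\<in>set us. a mod 16 \<noteq> fst (fst u)"
      then show "m a = m0 a" using st(5) increment_zero[OF us] by simp
    qed simp
    define m' where "m' = fold eval (pass_body us) m"
    have m': "m' = (\<lambda>a. (m(4 := Suc i, 5 := i mod n, 6 := quad_at ds i 0, 7 := quad_at ds i 1,
      8 := quad_at ds i 2, 9 := quad_at ds i 3)) a + increment us m0 (quad_at ds i) a)"
      using pass_body_eval[OF us st(1)] i unfolding m'_def st(3) inc n_def by simp
    have big: "m' a = m a + increment us m0 (quad_at ds i) a" if "a \<ge> 16" for a
      using that unfolding m' by auto
    have npos: "n > 0" using i by (cases n) auto
    have ij: "i div n < n" "i mod n < n" using i npos by (auto simp: less_mult_imp_div_less)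
    have dsB: "fst (ds ! t) \<le> B \<and> snd (ds ! t) \<le> B" if "t < n" for t
      using that s(1,4) unfolding stored_def n_def by metis
    have "n \<le> B" using B(2) npos unfolding n_def[symmetric] by (meson le_trans le_square)
    then have "i mod n \<le> B" using ij(2) by linarith
    then have small: "\<forall>a<16. m' a \<le> B"
      unfolding m' using st(4) increment_reg[of _ us m0] dsB[OF ij(1)] dsB[OF ij(2)] i B(2)
      by (auto simp: quad_at_def n_def[symmetric])
    have "stored ds m'"
      using st(1) unfolding stored_def by (simp add: big arr) (simp add: m' increment_reg)
    moreover have "m' 3 = n * n" "m' 4 = Suc i" using st(2) by (simp_all add: m' increment_reg)
    ultimately show ?thesis
      unfolding Inv_def m'_def[symmetric] using small big st(5) by simp
  qed
  have "\<exists>m'. Inv (n * n) m' \<and> reach P h (B' ^ (2 ^ length (pass_body us))) s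
     (s\<lparr>mem := m', pc := pc s + length (pass_body us) + 4, clock := clock s + 3 + n * n * (length (pass_body us) + 2)\<rparr>)"
  proof (rule loop_reach[OF code])
    show "straight_code B' (pass_body us)"
      using straight_pass_body[OF us] by (rule straight_code_mono) (use B BB' in simp)
    show "2 \<le> B'" using B(1) BB' by simp
    show "\<forall>a. mem s a \<le> B'" using s(4) BB' by (meson order_trans)
    show "Inv 0 ((mem s)(4 := 0))" by (rule init)
    show "\<And>i m. i < n * n \<Longrightarrow> Inv i m \<Longrightarrow> Inv (Suc i) (fold eval (pass_body us) m)" by (rule step)
    show "\<And>i m. i \<le> n * n \<Longrightarrow> Inv i m \<Longrightarrow> m 4 = i \<and> m 3 = n * n \<and> (\<forall>a. m a \<le> B')"
      using bound unfolding Inv_def by blast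
  qed
  then obtain m' where m': "Inv (n * n) m'" "reach P h (B' ^ (2 ^ length (pass_body us))) s
     (s\<lparr>mem := m', pc := pc s + length (pass_body us) + 4, clock := clock s + 3 + n * n * (length (pass_body us) + 2)\<rparr>)"
    by blast
  have "tables (pass (set ds) us T) m'"
    unfolding tables_def
  proof (intro allI impI)
    fix l x y :: nat assume l: "l < 12"
    have "m' (cell l x y) = m0 (cell l x y) + (\<Sum>t<n * n. increment us m0 (quad_at ds t) (cell l x y))"
      using m'(1) cell_ge[of l x y] unfolding Inv_def by blast
    also have "(\<Sum>t<n * n. increment us m0 (quad_at ds t) (cell l x y)) =
        (\<Sum>p\<in>set ds. \<Sum>q\<in>set ds. increment us m0 (quad p q) (cell l x y))"
      unfolding n_def by (rule sum_quad_at[OF ds])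
    also have "m0 (cell l x y) + \<dots> = pass (set ds) us T l x y"
      unfolding pass_def increment_tables[OF us s(3)[folded m0_def] l]
      using s(3) l by (simp add: tables_def m0_def)
    finally show "m' (cell l x y) = pass (set ds) us T l x y" .
  qed
  then show ?thesis using m' bound[OF m'(1)] unfolding Inv_def n_def by blast
qed

section \<open>Sequences of passes\<close>

fun passes_code :: "nat \<Rightarrow> upd list list \<Rightarrow> instr list" where
  "passes_code n [] = []"
| "passes_code n (us # uss) = loop_code n (pass_body us) @ passes_code (n + length (pass_body us) + 4) uss"

text \<open>The constants \<open>e'\<close> and \<open>c\<close> are fixed before the program, the
  host and \<open>S\<close>: each pass raises the exponent by an amount that depends only on the
  pass and on the exponent before it. \<open>S\<close> will be
  \<open>2 + input_size h\<close>.\<close>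

lemma passes_reach:
  assumes "\<forall>us\<in>set uss. valid_pass us"
  shows "\<exists>e' c. e \<le> e' \<and> (\<forall>P h s ds T S. 2 \<le> S \<longrightarrow> code_at P (pc s) (passes_code (pc s) uss) \<longrightarrow>
     stored ds (mem s) \<longrightarrow> mem s 3 = length ds * length ds \<longrightarrow> tables T (mem s) \<longrightarrow>
     (\<forall>a. mem s a \<le> S ^ e) \<longrightarrow> distinct ds \<longrightarrow> 16 \<le> S ^ e \<longrightarrow> length ds * length ds \<le> S ^ e \<longrightarrow>
     (\<exists>m' t. tables (fold (pass (set ds)) uss T) m' \<and>
       (\<forall>a. m' a \<le> S ^ e') \<and> t \<le> c * (1 + length ds * length ds) \<and>
       reach P h (S ^ e') s (s\<lparr>mem := m', pc := pc s + length (passes_code (pc s) uss), clock := clock s + t\<rparr>)))"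
  using assms
proof (induction uss arbitrary: e)
  case Nil
  show ?case
    by (intro exI[of _ e] exI[of _ 0] conjI allI impI order_refl, rule exI, rule exI[of _ 0])
      (auto intro: reach_refl)
next
  case (Cons us uss)
  define F where "F = sum_list (map (\<lambda>u. length (snd u)) us)"
  have F: "\<forall>u\<in>set us. length (snd u) \<le> F"
    unfolding F_def by (intro ballI member_le_sum_list) (simp_all add: rev_image_eqI)
  define q where "q = length (pass_body us)"
  \<comment> \<open>The number of iterations, the number of updates and the size of a product
    together contribute at most \<open>S ^ (e + length us + e * F)\<close>. The further
    \<open>e\<close> and 1 leave room for the old contents and for a factor 2.\<close>
  define e1 where "e1 = 1 + e + (e + length us + e * F)"
  obtain e2 c where e2: "e1 \<le> e2" and IH: "\<And>P h s ds T S. 2 \<le> S \<Longrightarrow> code_at P (pc s) (passes_code (pc s) uss) \<Longrightarrow>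
     stored ds (mem s) \<Longrightarrow> mem s 3 = length ds * length ds \<Longrightarrow> tables T (mem s) \<Longrightarrow>
     (\<forall>a. mem s a \<le> S ^ e1) \<Longrightarrow> distinct ds \<Longrightarrow> 16 \<le> S ^ e1 \<Longrightarrow> length ds * length ds \<le> S ^ e1 \<Longrightarrow>
     (\<exists>m' t. tables (fold (pass (set ds)) uss T) m' \<and>
       (\<forall>a. m' a \<le> S ^ e2) \<and> t \<le> c * (1 + length ds * length ds) \<and>
       reach P h (S ^ e2) s (s\<lparr>mem := m', pc := pc s + length (passes_code (pc s) uss), clock := clock s + t\<rparr>))"
    using Cons.IH[of e1] Cons.prems by auto
  have valid: "valid_pass us" using Cons.prems by simp
  \<comment> \<open>\<open>e2\<close> serves the remaining passes, the other summand the
    intermediate values inside the body of the present one.\<close>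
  define e' where "e' = e2 + e1 * 2 ^ q"
  have goal: "\<exists>m' t. tables (fold (pass (set ds)) (us # uss) T) m' \<and>
       (\<forall>a. m' a \<le> S ^ e') \<and> t \<le> (q + 5 + c) * (1 + length ds * length ds) \<and>
       reach P h (S ^ e') s (s\<lparr>mem := m', pc := pc s + length (passes_code (pc s) (us # uss)), clock := clock s + t\<rparr>)"
    if S: "2 \<le> S" and code: "code_at P (pc s) (passes_code (pc s) (us # uss))"
      and s: "stored ds (mem s)" "mem s 3 = length ds * length ds" "tables T (mem s)" "\<forall>a. mem s a \<le> S ^ e"
      and ds: "distinct ds" and B: "16 \<le> S ^ e" "length ds * length ds \<le> S ^ e"
    for P h s ds T and S :: nat
  proof -
    let ?N = "length ds * length ds"
    have pw: "S ^ i \<le> S ^ j" if "i \<le> j" for i j using S that by (intro power_increasing) auto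
    have "length us \<le> S ^ length us"
      using S by (meson less_exp less_imp_le order_trans power_mono zero_le)
    then have "?N * (length us * (S ^ e) ^ F) \<le> S ^ e * (S ^ length us * (S ^ e) ^ F)"
      using B(2) by (intro mult_le_mono) auto
    also have "\<dots> = S ^ (e + length us + e * F)" by (simp add: power_add power_mult)
    also have "\<dots> \<le> S ^ (e + (e + length us + e * F))" by (rule pw) simp
    finally have "S ^ e + ?N * (length us * (S ^ e) ^ F) \<le> 2 * S ^ (e + (e + length us + e * F))"
      using pw[of e "e + (e + length us + e * F)"] by simp
    also have "\<dots> \<le> S ^ e1" using S by (simp add: e1_def)
    finally have B': "S ^ e + ?N * (length us * (S ^ e) ^ F) \<le> S ^ e1" .
    have code1: "code_at P (pc s) (loop_code (pc s) (pass_body us))"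
      and code2: "code_at P (pc s + q + 4) (passes_code (pc s + q + 4) uss)"
      using code by (simp_all add: code_at_append q_def add.assoc)
    obtain m1 where m1: "stored ds m1" "m1 3 = ?N" "tables (pass (set ds) us T) m1" "\<forall>a. m1 a \<le> S ^ e1"
      and r1: "reach P h ((S ^ e1) ^ (2 ^ q)) s (s\<lparr>mem := m1, pc := pc s + q + 4, clock := clock s + 3 + ?N * (q + 2)\<rparr>)"
      using pass_reach[OF valid F code1 s ds B B', of h] unfolding q_def by blast
    define s1 where "s1 = s\<lparr>mem := m1, pc := pc s + q + 4, clock := clock s + 3 + ?N * (q + 2)\<rparr>"
    have "16 \<le> S ^ e1" "?N \<le> S ^ e1" using B pw[of e e1] by (auto simp: e1_def)
    then obtain m' t where m': "tables (fold (pass (set ds)) uss (pass (set ds) us T)) m'"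
       "\<forall>a. m' a \<le> S ^ e2" "t \<le> c * (1 + ?N)"
       "reach P h (S ^ e2) s1 (s1\<lparr>mem := m', pc := pc s1 + length (passes_code (pc s1) uss), clock := clock s1 + t\<rparr>)"
      using IH[of S P s1 ds "pass (set ds) us T" h] S code2 m1 ds unfolding s1_def by auto
    have "(S ^ e1) ^ (2 ^ q) \<le> S ^ e'" unfolding power_mult[symmetric] by (rule pw) (simp add: e'_def)
    moreover have le2: "S ^ e2 \<le> S ^ e'" by (rule pw) (simp add: e'_def)
    ultimately have "reach P h (S ^ e') s (s1\<lparr>mem := m', pc := pc s1 + length (passes_code (pc s1) uss), clock := clock s1 + t\<rparr>)"
      using reach_trans[OF reach_mono[OF r1] reach_mono[OF m'(4)[unfolded s1_def]]] unfolding s1_def by blast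
    moreover have "s1\<lparr>mem := m', pc := pc s1 + length (passes_code (pc s1) uss), clock := clock s1 + t\<rparr> =
       s\<lparr>mem := m', pc := pc s + length (passes_code (pc s) (us # uss)), clock := clock s + (3 + ?N * (q + 2) + t)\<rparr>"
      by (simp add: s1_def q_def add.assoc)
    moreover have "3 + ?N * (q + 2) + t \<le> (q + 5 + c) * (1 + ?N)" using m'(3) by (simp add: algebra_simps)
    moreover have "\<forall>a. m' a \<le> S ^ e'" using m'(2) le2 by (meson order_trans)
    ultimately show ?thesis using m'(1) by (metis fold_simps(2))
  qed
  have "e \<le> e'" using e2 by (simp add: e'_def e1_def)
  then show ?case using goal by blast
qed

section \<open>Reading the edges\<close>

text \<open>Register 14 is not advanced here, so the written pair joins the list only if the length
  is increased afterwards.\<close>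

definition push_code :: "nat \<Rightarrow> instr list" where
  "push_code b =
     [Add 12 14 1, Mul 12 12 2, Const 13 12, Add 12 12 13, Store 12 6, Add 12 12 1, Store 12 b]"

lemma push_code_eval:
  assumes "m 1 = 1" "m 2 = 16" "b < 12"
  shows "fold eval (push_code b) m =
     m(12 := 16 * m 14 + 29, 13 := 12, 16 * m 14 + 28 := m 6, 16 * m 14 + 29 := m b)"
  using assms by (auto simp: push_code_def fun_eq_iff algebra_simps)

text \<open>
  To avoid branching, the pair \<open>(x, x)\<close> is always written behind the list, but the length grows only
  if the entry \<open>(x, x)\<close> of table 0 was still 0.
\<close>

definition read_code :: "instr list" where
  "read_code = push_code 7 @ [Add 14 14 1] @ push_code 6 @
     addr_code (0, 0, 0) @ [Load 13 12, Sub 13 1 13, Add 14 14 13, Store 12 1] @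
     addr_code (1, 0, 1) @ [Store 12 1, Const 12 0, Const 13 0]"

definition read_tables :: "(nat \<times> nat) set \<Rightarrow> nat \<Rightarrow> nat \<Rightarrow> nat \<Rightarrow> nat" where
  "read_tables D l x y = (if l = 0 then of_bool (x = y \<and> x \<in> Domain D)
     else if l = 1 then of_bool ((x, y) \<in> D) else 0)"

text \<open>The offsets 44 and 45 are 28 and 29 one row further on, where \<open>(x, x)\<close> is
  put behind \<open>(x, y)\<close>.\<close>

lemma read_code_eval:
  assumes m: "m 1 = 1" "m 2 = 16"
  defines "n \<equiv> m 14" and "x \<equiv> m 6" and "y \<equiv> m 7"
  shows "fold eval read_code m =
    m(16 * n + 28 := x, 16 * n + 29 := y, 16 * n + 44 := x, 16 * n + 45 := x,
      cell 0 x x := 1, cell 1 x y := 1, 14 := n + 1 + (1 - m (cell 0 x x)), 12 := 0, 13 := 0)"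
proof -
  have ne: "cell l a b \<noteq> 16 * t + 28" "cell l a b \<noteq> 16 * t + 29"
    "cell l a b \<noteq> 16 * t + 44" "cell l a b \<noteq> 16 * t + 45" if "l < 12" for l a b t
    using cell_mod[of l a b] that by (auto simp: mod_mult_self4)
  define m1 where "m1 = m(12 := 16 * n + 45, 13 := 12, 16 * n + 28 := x, 16 * n + 29 := y, 14 := n + 1,
     16 * n + 44 := x, 16 * n + 45 := x)"
  have 1: "fold eval (push_code 7 @ [Add 14 14 1] @ push_code 6) m = m1"
    using m by (auto simp: push_code_eval m1_def n_def x_def y_def fun_eq_iff)
  have r1: "regs m1 0 = x" "regs m1 1 = y" "m1 1 = 1" "m1 2 = 16"
    using m by (simp_all add: regs_def m1_def x_def y_def)
  define m2 where "m2 = m1(13 := 1 - m (cell 0 x x), 12 := cell 0 x x, 14 := n + 1 + (1 - m (cell 0 x x)), cell 0 x x := 1)"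
  have c0: "m1 (cell 0 x x) = m (cell 0 x x)"
    using ne[of 0 x x] cell_neq_reg[of _ 0 x x] by (simp add: m1_def)
  have a1: "fold eval (addr_code (0, 0, 0)) m1 = m1(13 := 0, 12 := cell 0 x x)"
    using addr_code_eval[of m1 0 0 0] r1 by simp
  have 2: "fold eval (addr_code (0, 0, 0) @ [Load 13 12, Sub 13 1 13, Add 14 14 13, Store 12 1]) m1 = m2"
    unfolding fold_append o_apply a1 using c0 r1 cell_neq_reg[of _ 0 x x]
    by (auto simp: m2_def fun_eq_iff m1_def)
  have r2: "regs m2 0 = x" "regs m2 1 = y" "m2 1 = 1" "m2 2 = 16"
    using r1 cell_neq_reg[of _ 0 x x] by (auto simp: regs_def m2_def)
  have a2: "fold eval (addr_code (1, 0, 1)) m2 = m2(13 := 1, 12 := cell 1 x y)"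
    using addr_code_eval[of m2 0 1 1] r2 by simp
  have 3: "fold eval (addr_code (1, 0, 1) @ [Store 12 1, Const 12 0, Const 13 0]) m2 = m2(cell 1 x y := 1, 12 := 0, 13 := 0)"
    unfolding fold_append o_apply a2 using r2 cell_neq_reg[of _ 1 x y]
    by (auto simp: fun_eq_iff)
  have "fold eval read_code m = m2(cell 1 x y := 1, 12 := 0, 13 := 0)"
    using 1 2 3 unfolding read_code_def by (simp only: append_assoc[symmetric] fold_append o_apply)
  also have "\<dots> = m(16 * n + 28 := x, 16 * n + 29 := y, 16 * n + 44 := x, 16 * n + 45 := x,
      cell 0 x x := 1, cell 1 x y := 1, 14 := n + 1 + (1 - m (cell 0 x x)), 12 := 0, 13 := 0)"
    using cell_neq_reg[of _ 0 x x] cell_neq_reg[of _ 1 x y] by (auto simp: m2_def m1_def fun_eq_iff)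
  finally show ?thesis .
qed

definition read_inv :: "(nat \<times> nat) list \<Rightarrow> nat \<Rightarrow> (nat \<Rightarrow> nat) \<Rightarrow> (nat \<times> nat) list \<Rightarrow> bool" where
  "read_inv es B m ds \<longleftrightarrow> stored ds m \<and> tables (read_tables (set es)) m \<and> distinct ds \<and>
     set ds = edge_pairs (set es) \<and> length ds \<le> 2 * length es \<and> (\<forall>a. m a \<le> B)"

lemma fun_upd_bound: "\<forall>a. m a \<le> B \<Longrightarrow> v \<le> B \<Longrightarrow> \<forall>a. (m(b := v)) a \<le> (B :: nat)"
  by simp

text \<open>Diagonal pairs are created for first components only. In the end every endpoint has one,
  as each edge is enumerated in both directions.\<close>

lemma read_step:
  assumes inv: "read_inv es B m ds" and new: "(x, y) \<notin> set es" "x \<noteq> y"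
    and B: "16 \<le> B" "x \<le> B" "y \<le> B" "2 * length es + 2 \<le> B"
  shows "\<exists>ds'. read_inv (es @ [(x, y)]) B (fold eval read_code (m(6 := x, 7 := y))) ds'"
proof -
  define n where "n = length ds"
  define b where "b = (1::nat) - of_bool (x \<in> Domain (set es))"
  define ds' where "ds' = ds @ [(x, y)] @ (if x \<in> Domain (set es) then [] else [(x, x)])"
  have st: "stored ds m" "tables (read_tables (set es)) m" "distinct ds" "set ds = edge_pairs (set es)"
    "n \<le> 2 * length es" "\<And>a. m a \<le> B" using inv unfolding read_inv_def n_def by auto
  have m0: "(m(6 := x, 7 := y)) (cell 0 x x) = of_bool (x \<in> Domain (set es))"
    using st(2) cell_neq_reg[of _ 0 x x] by (simp add: tables_def read_tables_def)
  define m' where "m' = fold eval read_code (m(6 := x, 7 := y))"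
  have m': "m' = m(6 := x, 7 := y, 16 * n + 28 := x, 16 * n + 29 := y, 16 * n + 44 := x, 16 * n + 45 := x,
      cell 0 x x := 1, cell 1 x y := 1, 14 := n + 1 + b, 12 := 0, 13 := 0)"
    unfolding m'_def using st(1) m0 by (subst read_code_eval) (simp_all add: stored_def n_def b_def)
  have len: "length ds' = n + 1 + b" by (simp add: ds'_def n_def b_def)
  have ne: "cell l a c \<noteq> 16 * t + 28" "cell l a c \<noteq> 16 * t + 29"
    "cell l a c \<noteq> 16 * t + 44" "cell l a c \<noteq> 16 * t + 45" if "l < 12" for l a c t
    using cell_mod[of l a c] that by (auto simp: mod_mult_self4)
  have tab: "tables (read_tables (set (es @ [(x, y)]))) m'"
    unfolding tables_def
  proof (intro allI impI)
    fix l a c :: nat assume l: "l < 12"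
    have "m' (cell l a c) = (if l = 0 \<and> a = x \<and> c = x \<or> l = 1 \<and> a = x \<and> c = y then 1 else m (cell l a c))"
      using l ne[OF l, of a c n] cell_neq_reg[of _ l a c] cell_inj[of l 0 a c x x] cell_inj[of l 1 a c x y]
      unfolding m' by auto
    also have "m (cell l a c) = read_tables (set es) l a c" using st(2) l by (simp add: tables_def)
    finally show "m' (cell l a c) = read_tables (set (es @ [(x, y)])) l a c"
      by (auto simp: read_tables_def)
  qed
  have reg: "m' 1 = 1 \<and> m' 2 = 16 \<and> m' 14 = length ds' \<and> m' 10 = 0 \<and> m' 11 = 0 \<and> m' 12 = 0 \<and> m' 13 = 0"
    using st(1) cell_neq_reg[of _ 0 x x] cell_neq_reg[of _ 1 x y] unfolding m' len
    by (simp add: stored_def)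
  have arr: "m' (16 * i + 28) = fst (ds' ! i) \<and> m' (16 * i + 29) = snd (ds' ! i)" if i: "i < length ds'" for i
  proof -
    have arith: "16 * i + 28 = 16 * n + 28 \<longleftrightarrow> i = n" "16 * i + 28 \<noteq> 16 * n + 29"
      "16 * i + 28 = 16 * n + 44 \<longleftrightarrow> i = Suc n"
      "16 * i + 28 \<noteq> 16 * n + 45" "16 * i + 29 \<noteq> 16 * n + 28" "16 * i + 29 = 16 * n + 29 \<longleftrightarrow> i = n"
      "16 * i + 29 \<noteq> 16 * n + 44" "16 * i + 29 = 16 * n + 45 \<longleftrightarrow> i = Suc n"
      by presburger+
    have v: "m' (16 * i + 28) = (if i = n then x else if i = Suc n then x else m (16 * i + 28))"
      "m' (16 * i + 29) = (if i = n then y else if i = Suc n then x else m (16 * i + 29))"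
    proof -
      have cells: "16 * i + 28 \<noteq> cell 0 x x" "16 * i + 28 \<noteq> cell 1 x y"
        "16 * i + 29 \<noteq> cell 0 x x" "16 * i + 29 \<noteq> cell 1 x y"
        using ne(1,2)[of 0 x x i] ne(1,2)[of 1 x y i] by simp_all
      have low: "16 * i + 28 \<noteq> r" "16 * i + 29 \<noteq> r" if "r < 16" for r using that by simp_all
      show "m' (16 * i + 28) = (if i = n then x else if i = Suc n then x else m (16 * i + 28))"
        "m' (16 * i + 29) = (if i = n then y else if i = Suc n then x else m (16 * i + 29))"
        unfolding m' fun_upd_apply arith
        by (simp_all only: arith cells low[of 6, simplified] low[of 7, simplified] low[of 12, simplified]
            low[of 13, simplified] low[of 14, simplified] if_False) simp_all
    qed
    consider "i < n" | "i = n" | "i = Suc n" "x \<notin> Domain (set es)"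
      using i unfolding len b_def by (cases "x \<in> Domain (set es)") (simp_all, linarith+)
    then show ?thesis
    proof cases
      case 1
      then show ?thesis using v st(1) by (simp add: stored_def ds'_def n_def nth_append)
    qed (use v in \<open>simp_all add: ds'_def n_def nth_append\<close>)
  qed
  have "(x, y) \<notin> set ds" using new st(4) by (auto simp: edge_pairs_def)
  moreover have "(x, x) \<notin> set ds" if "x \<notin> Domain (set es)" using that st(4) by (auto simp: edge_pairs_def)
  ultimately have "distinct ds'" using st(3) new(2) by (auto simp: ds'_def)
  moreover have "set ds' = edge_pairs (set (es @ [(x, y)]))"
    using st(4) by (auto simp: ds'_def edge_pairs_def Id_on_def)
  moreover have "length ds' \<le> 2 * length (es @ [(x, y)])" using st(5) unfolding len b_def by simp
  moreover have "\<forall>a. m' a \<le> B"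
    unfolding m' by (intro fun_upd_bound) (use st(5,6) B in \<open>auto simp: b_def\<close>)
  ultimately show ?thesis
    unfolding read_inv_def m'_def[symmetric] stored_def using tab reg arr by blast
qed

text \<open>With q = \<open>length read_code\<close>, addresses 2 to q + 3 form the reading loop.
  Its exit q + 4 stores the squared length of the list, the bound of all later loops.\<close>

definition prelude_code :: "instr list" where
  "prelude_code = [Const 1 1, Const 2 16, Next 6 7 (length read_code + 4)] @ read_code @ [Jump 2, Mul 3 14 14]"

lemma straight_read_code: "straight_code 16 read_code"
  by (simp add: read_code_def push_code_def)

lemma prelude_reach:
  assumes code: "code_at P 0 prelude_code" and h: "valid_host h"
    and B: "16 \<le> B" "card (verts (host_graph h)) \<le> B" "2 * length (edge_seq h) * (2 * length (edge_seq h)) + 2 \<le> B"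
  shows "\<exists>m ds. stored ds m \<and> m 3 = length ds * length ds \<and> tables (read_tables (set (edge_seq h))) m \<and>
     distinct ds \<and> set ds = edge_pairs (set (edge_seq h)) \<and> length ds \<le> 2 * length (edge_seq h) \<and> (\<forall>a. m a \<le> B) \<and>
     reach P h (B ^ (2 ^ length read_code)) init_state
       \<lparr>pc = length prelude_code, mem = m, pos = length (edge_seq h),
        clock = 4 + (\<Sum>i<length (edge_seq h). next_cost h i) + length (edge_seq h) * (length read_code + 2)\<rparr>"
proof -
  define q where "q = length read_code"
  define es where "es = edge_seq h"
  define M where "M = B ^ (2 ^ q)"
  have BM: "B \<le> M" unfolding M_def using B(1) by (simp add: self_le_power)
  have c: "0 < length P" "P ! 0 = Const 1 1" "1 < length P" "P ! 1 = Const 2 16"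
    "2 < length P" "P ! 2 = Next 6 7 (q + 4)" "code_at P 3 read_code"
    "3 + q < length P" "P ! (3 + q) = Jump 2" "4 + q < length P" "P ! (4 + q) = Mul 3 14 14"
    using code unfolding prelude_code_def q_def
    by (simp_all add: code_at_append code_at_Cons eval_nat_numeral)
  have edge: "x < card (verts (host_graph h)) \<and> y < card (verts (host_graph h)) \<and> x \<noteq> y"
    if "(x, y) \<in> set es" for x y
  proof -
    have e: "{x, y} \<in> edges (host_graph h)" using h that by (auto simp: valid_host_def es_def)
    have "simple_graph (host_graph h)" using h by (simp add: valid_host_def)
    with e have "{x, y} \<subseteq> verts (host_graph h)" "card {x, y} = 2"
      unfolding simple_graph_def by blast+
    moreover have "verts (host_graph h) = {..<card (verts (host_graph h))}"
      using h unfolding valid_host_def by blast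
    ultimately show ?thesis by (auto simp: card_insert_if split: if_splits)
  qed
  \<comment> \<open>An iteration costs \<open>next_cost\<close> and 1 for \<open>Next\<close>, then
    q for the body and 1 for the jump back.\<close>
  define st where "st p m = \<lparr>pc = 2, mem = m, pos = p,
     clock = 2 + (\<Sum>i<p. next_cost h i) + p * (q + 2)\<rparr>" for p m
  have len2: "2 * length es + 2 \<le> B"
    using B(3) unfolding es_def[symmetric] by (meson add_le_mono1 le_square order_trans)
  have iter: "\<exists>m ds. read_inv (take p es) B m ds \<and> reach P h M init_state (st p m)" if "p \<le> length es" for p
    using that
  proof (induction p)
    case 0
    define s1 where "s1 = \<lparr>pc = 1, mem = (\<lambda>_. 0)(1 := 1), pos = 0, clock = 1\<rparr>"
    define m where "m = (\<lambda>_::nat. 0::nat)(1 := 1, 2 := 16)"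
    have "reach P h M init_state s1"
      by (rule reach_step) (use c B(1) BM in \<open>auto simp: init_state_def s1_def set_cell_def\<close>)
    moreover have "reach P h M s1 (st 0 m)"
      by (rule reach_step) (use c B(1) BM in \<open>auto simp: st_def m_def s1_def set_cell_def\<close>)
    moreover have "read_inv (take 0 es) B m []"
      using B(1) cell_neq_reg unfolding read_inv_def stored_def tables_def read_tables_def
      by (auto simp: m_def edge_pairs_def)
    ultimately show ?case using reach_trans by blast
  next
    case (Suc p)
    then obtain m ds where m: "read_inv (take p es) B m ds" "reach P h M init_state (st p m)" by auto
    obtain x y where xy: "es ! p = (x, y)" by (cases "es ! p")
    have p: "p < length es" using Suc.prems by simp
    have xy_in: "(x, y) \<in> set es" using nth_mem[OF p] xy by simp
    have tk: "take (Suc p) es = take p es @ [(x, y)]" using p xy by (simp add: take_Suc_conv_app_nth)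
    have "distinct es" using h by (simp add: valid_host_def es_def)
    then have new: "(x, y) \<notin> set (take p es)"
      using p xy by (metis distinct_take tk not_distinct_conv_prefix)
    have xyB: "x \<le> B" "y \<le> B" using edge[OF xy_in] B(2) by auto
    have "\<exists>ds'. read_inv (take p es @ [(x, y)]) B (fold eval read_code (m(6 := x, 7 := y))) ds'"
      using m(1) new edge[OF xy_in] B(1) xyB len2 p by (intro read_step) auto
    then obtain ds' where ds': "read_inv (take (Suc p) es) B (fold eval read_code (m(6 := x, 7 := y))) ds'"
      unfolding tk by blast
    have mB: "\<forall>a. m a \<le> B" using m(1) by (simp add: read_inv_def)
    have mM: "\<forall>a. m a \<le> M" using mB BM by (meson order_trans)
    define s1 where "s1 = \<lparr>pc = 3, mem = m(6 := x, 7 := y), pos = Suc p,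
      clock = clock (st p m) + 1 + next_cost h p\<rparr>"
    have r1: "reach P h M (st p m) s1"
      by (rule reach_step) (use c mM p xy xyB BM in \<open>auto simp: st_def s1_def es_def[symmetric]\<close>)
    define s2 where "s2 = s1\<lparr>mem := fold eval read_code (m(6 := x, 7 := y)), pc := 3 + q, clock := clock s1 + q\<rparr>"
    have r2: "reach P h M s1 s2"
      using straight_reach[of P s1 read_code B h] c(7) straight_code_mono[OF straight_read_code B(1)] mB xyB B(1)
      unfolding M_def s2_def q_def by (simp add: s1_def)
    have "\<forall>a. fold eval read_code (m(6 := x, 7 := y)) a \<le> M"
      using ds' BM unfolding read_inv_def by (meson order_trans)
    then have r3: "reach P h M s2 (st (Suc p) (fold eval read_code (m(6 := x, 7 := y))))"
      by (intro reach_step) (use c in \<open>auto simp: s2_def s1_def st_def algebra_simps\<close>)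
    show ?case using ds' reach_trans[OF reach_trans[OF reach_trans[OF m(2) r1] r2] r3] by blast
  qed
  then obtain m ds where m: "read_inv es B m ds" "reach P h M init_state (st (length es) m)"
    using iter[of "length es"] by auto
  have mB: "\<forall>a. m a \<le> B" using m(1) by (simp add: read_inv_def)
  have mM: "\<forall>a. m a \<le> M" using mB BM by (meson order_trans)
  define s1 where "s1 = (st (length es) m)\<lparr>pc := q + 4, clock := clock (st (length es) m) + 1\<rparr>"
  have r1: "reach P h M (st (length es) m) s1"
    by (rule reach_step) (use c mM in \<open>auto simp: st_def s1_def es_def\<close>)
  define m' where "m' = m(3 := length ds * length ds)"
  have "length ds * length ds \<le> 2 * length es * (2 * length es)"
    using m(1) unfolding read_inv_def by (intro mult_le_mono) auto
  then have lB: "length ds * length ds \<le> B" using B(3) unfolding es_def by linarith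
  have m'B: "\<forall>a. m' a \<le> B" using mB lB by (simp add: m'_def)
  then have m'M: "\<forall>a. m' a \<le> M" using BM by (meson order_trans)
  define s2 where "s2 = s1\<lparr>pc := q + 5, mem := m', clock := clock s1 + 1\<rparr>"
  have "m 14 = length ds" using m(1) by (simp add: read_inv_def stored_def)
  then have r2: "reach P h M s1 s2"
    by (intro reach_step) (use c mM m'M in \<open>auto simp: st_def s1_def s2_def set_cell_def m'_def add.commute\<close>)
  have "stored ds m'" "tables (read_tables (set es)) m'"
    using m(1) cell_neq_reg unfolding read_inv_def by (auto simp: m'_def stored_def tables_def)
  moreover have "s2 = \<lparr>pc = length prelude_code, mem = m', pos = length es,
        clock = 4 + (\<Sum>i<length es. next_cost h i) + length es * (q + 2)\<rparr>"
    by (simp add: s2_def s1_def st_def prelude_code_def q_def)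
  moreover have "m' 3 = length ds * length ds" by (simp add: m'_def)
  ultimately show ?thesis
    using m(1) m'B reach_trans[OF reach_trans[OF m(2) r1] r2]
    unfolding read_inv_def es_def q_def M_def by metis
qed

section \<open>The program\<close>

text \<open>The factor \<open>(1, 0, 1)\<close> selects the pairs p = (x, z) that are edges,
  \<open>(0, 2, 3)\<close> the diagonal pairs q = (y, y), and \<open>(l, 1, 2)\<close> reads the
  number of walks from z to y. Added to the entry of (x, y), the products realise the recurrence for
  \<open>Suc l\<close>.\<close>

definition walk_pass :: "nat \<Rightarrow> upd list" where
  "walk_pass l = [((Suc l, 0, 2), [(1, 0, 1), (0, 2, 3), (l, 1, 2)])]"

definition sum_pass :: "factor list list \<Rightarrow> factor list list \<Rightarrow> upd list" where
  "sum_pass ps ns = map (Pair (10, 4, 4)) ps @ map (Pair (11, 4, 4)) ns"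

lemma valid_walk_pass: "1 \<le> l \<Longrightarrow> l \<le> 8 \<Longrightarrow> valid_pass (walk_pass l)"
  by (auto simp: walk_pass_def valid_pass_def valid_upd_def small_index_def)

lemma valid_sum_pass:
  assumes "\<forall>fs\<in>set (ps @ ns). small_factors fs"
  shows "valid_pass (sum_pass ps ns)"
  using assms by (fastforce simp: sum_pass_def valid_pass_def valid_upd_def small_index_def small_factors_def)

definition walk_tables :: "(nat \<times> nat) set \<Rightarrow> nat \<Rightarrow> nat \<Rightarrow> nat \<Rightarrow> nat \<Rightarrow> nat" where
  "walk_tables D n l x y = (if l \<le> n then walks D l x y else 0)"

lemma read_tables_walks: "graph_relation D \<Longrightarrow> read_tables D = walk_tables D 1"
  by (auto simp: fun_eq_iff read_tables_def walk_tables_def walks_1 le_Suc_eq simp del: walks.simps(2))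

lemma sum_first_edge:
  assumes D: "graph_relation D"
  shows "(\<Sum>p\<in>edge_pairs D. of_bool (fst p = x \<and> p \<in> D) * f (snd p)) =
     (\<Sum>z\<in>Domain D. of_bool ((x, z) \<in> D) * (f z :: nat))"
proof -
  have sub: "{z. (x, z) \<in> D} \<subseteq> Domain D"
    using D symD[of D x] unfolding graph_relation_def by blast
  have "(\<Sum>z\<in>Domain D. of_bool ((x, z) \<in> D) * f z) = (\<Sum>z\<in>{z. (x, z) \<in> D}. f z)"
    using sub by (intro sum.mono_neutral_cong_right finite_Domain_graph[OF D]) auto
  also have "\<dots> = (\<Sum>p\<in>Pair x ` {z. (x, z) \<in> D}. f (snd p))"
    by (subst sum.reindex) (auto simp: inj_on_def)
  also have "\<dots> = (\<Sum>p\<in>edge_pairs D. of_bool (fst p = x \<and> p \<in> D) * f (snd p))"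
    by (rule sum.mono_neutral_cong_left) (auto simp: finite_edge_pairs[OF D], auto simp: edge_pairs_def)
  finally show ?thesis ..
qed

lemma sum_diagonal:
  assumes D: "graph_relation D"
  shows "(\<Sum>q\<in>edge_pairs D. of_bool (fst q = y) * walks D 0 (fst q) (snd q)) = of_bool (y \<in> Domain D)"
proof -
  have "(\<Sum>q\<in>edge_pairs D. of_bool (fst q = y) * walks D 0 (fst q) (snd q)) =
      (\<Sum>q\<in>edge_pairs D. if q = (y, y) then of_bool (y \<in> Domain D) else 0)"
    by (intro sum.cong) (auto simp: prod_eq_iff)
  also have "\<dots> = of_bool (y \<in> Domain D)"
    using finite_edge_pairs[OF D] by (simp add: edge_pairs_def Id_on_def)
  finally show ?thesis .
qed

text \<open>The double sum factorizes: the sum over \<open>p\<close> is the recurrence for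
  \<open>walks\<close>, and the sum over \<open>q\<close> meets only the diagonal pair
  \<open>(y, y)\<close>.\<close>

lemma pass_walk_pass:
  assumes D: "graph_relation D" and n: "1 \<le> n"
  shows "pass (edge_pairs D) (walk_pass n) (walk_tables D n) = walk_tables D (Suc n)"
proof (intro ext)
  fix l x y
  have "(\<Sum>p\<in>edge_pairs D. \<Sum>q\<in>edge_pairs D. \<Sum>u\<leftarrow>walk_pass n.
     of_bool (fst (fst u) = l \<and> quad p q (fst (snd (fst u))) = x \<and> quad p q (snd (snd (fst u))) = y) *
     monomial (walk_tables D n) (snd u) (quad p q)) =
     (\<Sum>p\<in>edge_pairs D. \<Sum>q\<in>edge_pairs D. of_bool (l = Suc n) *
       ((of_bool (fst p = x \<and> p \<in> D) * walks D n (snd p) y) * (of_bool (fst q = y) * walks D 0 (fst q) (snd q))))"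
    using n by (intro sum.cong refl) (auto simp: walk_pass_def walk_tables_def walks_1[OF D] simp del: walks.simps)
  also have "\<dots> = of_bool (l = Suc n) * ((\<Sum>p\<in>edge_pairs D. of_bool (fst p = x \<and> p \<in> D) * walks D n (snd p) y) *
      (\<Sum>q\<in>edge_pairs D. of_bool (fst q = y) * walks D 0 (fst q) (snd q)))"
    by (simp only: sum_distrib_left[symmetric] sum_distrib_right[symmetric])
  also have "\<dots> = of_bool (l = Suc n) * (walks D (Suc n) x y * of_bool (y \<in> Domain D))"
    unfolding sum_first_edge[OF D, of x "\<lambda>z. walks D n z y"] sum_diagonal[OF D] by simp
  also have "walks D (Suc n) x y * of_bool (y \<in> Domain D) = walks D (Suc n) x y"
    using walks_Domain[of D "Suc n" x y] by (cases "walks D (Suc n) x y = 0") auto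
  finally have "pass (edge_pairs D) (walk_pass n) (walk_tables D n) l x y =
     walk_tables D n l x y + of_bool (l = Suc n) * walks D (Suc n) x y"
    unfolding pass_def by simp
  then show "pass (edge_pairs D) (walk_pass n) (walk_tables D n) l x y = walk_tables D (Suc n) l x y"
    by (simp add: walk_tables_def le_Suc_eq del: walks.simps)
qed

lemma fold_walk_passes:
  assumes D: "graph_relation D" and "1 \<le> n"
  shows "fold (pass (edge_pairs D)) (map walk_pass [1..<n]) (walk_tables D 1) = walk_tables D n"
  using assms(2)
proof (induction n rule: dec_induct)
  case (step n)
  then show ?case by (simp add: pass_walk_pass[OF D])
qed simp

lemma pass_sum_pass:
  assumes "\<forall>fs\<in>set (ps @ ns). small_factors fs"
  shows "pass (edge_pairs D) (sum_pass ps ns) (walk_tables D 9) 10 0 0 = (\<Sum>fs\<leftarrow>ps. quad_sum D fs)"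
    and "pass (edge_pairs D) (sum_pass ps ns) (walk_tables D 9) 11 0 0 = (\<Sum>fs\<leftarrow>ns. quad_sum D fs)"
proof -
  have mono: "monomial (walk_tables D 9) fs v = monomial (walks D) fs v" if "small_factors fs" for fs v
    using that by (intro monomial_cong) (auto simp: small_factors_def walk_tables_def)
  have sums: "(\<Sum>p\<in>edge_pairs D. \<Sum>q\<in>edge_pairs D. \<Sum>fs\<leftarrow>xs. monomial (walk_tables D 9) fs (quad p q)) =
      (\<Sum>fs\<leftarrow>xs. quad_sum D fs)" if "\<forall>fs\<in>set xs. small_factors fs" for xs
    using that by (induction xs) (simp_all add: sum.distrib quad_sum_def mono)
  show "pass (edge_pairs D) (sum_pass ps ns) (walk_tables D 9) 10 0 0 = (\<Sum>fs\<leftarrow>ps. quad_sum D fs)"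
    "pass (edge_pairs D) (sum_pass ps ns) (walk_tables D 9) 11 0 0 = (\<Sum>fs\<leftarrow>ns. quad_sum D fs)"
    using sums[of ps] sums[of ns] assms
    by (simp_all add: pass_def sum_pass_def o_def walk_tables_def)
qed

text \<open>Cells 26 and 27 are the accumulators \<open>cell 10 0 0\<close> and \<open>cell 11 0 0\<close>.\<close>

definition cycle_program :: "factor list list \<Rightarrow> factor list list \<Rightarrow> nat \<Rightarrow> program" where
  "cycle_program ps ns a = prelude_code @
     passes_code (length prelude_code) (map walk_pass [1..<9] @ [sum_pass ps ns]) @
     [Sub 0 26 27, Const 13 a, Div 0 0 13]"

section \<open>Correctness and running time\<close>

lemma length_edge_seq:
  assumes "valid_host h" shows "length (edge_seq h) \<le> 2 * num_edges h"
proof -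
  let ?E = "edges (host_graph h)"
  have h: "simple_graph (host_graph h)" "distinct (edge_seq h)" "set (edge_seq h) = {(x, y). {x, y} \<in> ?E}"
    using assms unfolding valid_host_def by auto
  have fin: "finite ?E" using finite_edges[OF h(1)] .
  have "set (edge_seq h) = (\<Union>e\<in>?E. {(x, y). {x, y} = e})" using h(3) by auto
  then have "length (edge_seq h) = card (\<Union>e\<in>?E. {(x, y). {x, y} = e})"
    using distinct_card[OF h(2)] by simp
  also have "\<dots> \<le> (\<Sum>e\<in>?E. card {(x, y). {x, y} = e})" using fin by (rule card_UN_le)
  also have "\<dots> \<le> (\<Sum>e\<in>?E. 2)"
  proof (rule sum_mono)
    fix e assume "e \<in> ?E"
    then have "card e = 2" using h(1) unfolding simple_graph_def by blast
    then obtain a b where "e = {a, b}" by (auto simp: card_2_iff)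
    then have "{(x, y). {x, y} = e} \<subseteq> {(a, b), (b, a)}" by (auto simp: doubleton_eq_iff)
    then have "card {(x, y). {x, y} = e} \<le> card {(a, b), (b, a)}" by (rule card_mono[rotated]) simp
    also have "\<dots> \<le> 2" by (cases "a = b") simp_all
    finally show "card {(x, y). {x, y} = e} \<le> 2" .
  qed
  finally show ?thesis unfolding num_edges_def by simp
qed

text \<open>A halted state is a fixed point of \<open>step\<close>. So the state at the least
  halting time is \<open>s\<close>, and the memory bound extends to all later times.\<close>

lemma reach_final:
  assumes "reach P h M init_state s" "halted P s"
  shows "halts P h" "final_state P h = s" "mem (run P h t) a \<le> M"
proof -
  obtain t0 where t0: "run P h t0 = s" "\<forall>i\<le>t0. \<forall>a. mem (run P h i) a \<le> M"
    using assms(1) unfolding reach_def run_def by blast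
  have stable: "run P h (i + j) = run P h i" if "halted P (run P h i)" for i j
  proof (induction j)
    case (Suc j)
    have "run P h (i + Suc j) = step P h (run P h (i + j))" by (simp add: run_def)
    then show ?case using Suc that by (simp add: step_def)
  qed simp
  show "halts P h" using assms(2) t0(1) unfolding halts_def by blast
  define l where "l = (LEAST t. halted P (run P h t))"
  have l: "halted P (run P h l)" "l \<le> t0"
    unfolding l_def using assms(2) t0(1) by (auto intro: LeastI Least_le)
  then show "final_state P h = s"
    using stable[of l "t0 - l"] t0(1) unfolding final_state_def l_def[symmetric] by simp
  show "mem (run P h t) a \<le> M"
  proof (cases "t \<le> t0")
    case False
    then have "run P h t = run P h t0" using stable[of t0 "t - t0"] assms(2) t0(1) by simp
    then show ?thesis using t0(2) by simp
  qed (use t0 in simp)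
qed

lemma cycle_program_correct:
  assumes small: "\<forall>fs\<in>set (ps @ ns). small_factors fs"
  shows "\<exists>e c. \<forall>h. valid_host h \<longrightarrow> halts (cycle_program ps ns a) h \<and>
     result (cycle_program ps ns a) h =
       ((\<Sum>fs\<leftarrow>ps. quad_sum (adjacency (host_graph h)) fs) -
        (\<Sum>fs\<leftarrow>ns. quad_sum (adjacency (host_graph h)) fs)) div a \<and>
     (\<forall>t b. mem (run (cycle_program ps ns a) h t) b \<le> (2 + input_size h) ^ e) \<and>
     running_time (cycle_program ps ns a) h \<le>
       (\<Sum>i<length (edge_seq h). next_cost h i) + c * (1 + num_edges h ^ 2)"
proof -
  define uss where "uss = map walk_pass [1..<9] @ [sum_pass ps ns]"
  have "\<forall>us\<in>set uss. valid_pass us"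
    using valid_sum_pass[OF small] valid_walk_pass by (auto simp: uss_def)
  \<comment> \<open>Exponent 7 suffices for the memory after reading: it covers the constant 16, the
    vertices, and the squared length of the list.\<close>
  from passes_reach[OF this, of 7] obtain e c where e: "7 \<le> e" and
    passes: "\<And>P h s ds T S. 2 \<le> S \<Longrightarrow> code_at P (pc s) (passes_code (pc s) uss) \<Longrightarrow>
     stored ds (mem s) \<Longrightarrow> mem s 3 = length ds * length ds \<Longrightarrow> tables T (mem s) \<Longrightarrow>
     (\<forall>a. mem s a \<le> S ^ 7) \<Longrightarrow> distinct ds \<Longrightarrow> 16 \<le> S ^ 7 \<Longrightarrow> length ds * length ds \<le> S ^ 7 \<Longrightarrow>
     (\<exists>m' t. tables (fold (pass (set ds)) uss T) m' \<and>
       (\<forall>a. m' a \<le> S ^ e) \<and> t \<le> c * (1 + length ds * length ds) \<and>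
       reach P h (S ^ e) s (s\<lparr>mem := m', pc := pc s + length (passes_code (pc s) uss), clock := clock s + t\<rparr>))"
    by (elim exE conjE) blast
  define P where "P = cycle_program ps ns a"
  define q where "q = length read_code"
  define L where "L = length prelude_code"
  \<comment> \<open>The summands cover the intermediate values while reading, during the passes, and
    in the last three instructions. There \<open>a\<close> enters because the divisor is a constant
    of the code, bounded by \<open>2 ^ a\<close>.\<close>
  define e' where "e' = 7 * 2 ^ q + (e + a) * 2 ^ 3"
  \<comment> \<open>7 counts the four single instructions around the reading loop and the last
    three. With m edges at most 2m pairs are read and the list has at most 4m entries, so a pass
    makes at most 16m^2 iterations.\<close>
  define C where "C = 7 + 4 * (q + 2) + 16 * c + c"
  have code: "code_at P 0 prelude_code" "code_at P L (passes_code L uss)"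
    "code_at P (L + length (passes_code L uss)) [Sub 0 26 27, Const 13 a, Div 0 0 13]"
    and lenP: "length P = L + length (passes_code L uss) + 3"
  proof -
    have "code_at P 0 P" unfolding code_at_def by auto
    then have "code_at P 0 (prelude_code @ passes_code L uss @ [Sub 0 26 27, Const 13 a, Div 0 0 13])"
      unfolding P_def cycle_program_def uss_def L_def by simp
    then show "code_at P 0 prelude_code" "code_at P L (passes_code L uss)"
      "code_at P (L + length (passes_code L uss)) [Sub 0 26 27, Const 13 a, Div 0 0 13]"
      unfolding code_at_append L_def by simp_all
    show "length P = L + length (passes_code L uss) + 3"
      by (simp add: P_def cycle_program_def L_def uss_def)
  qed
  have "halts P h \<and> result P h =
       ((\<Sum>fs\<leftarrow>ps. quad_sum (adjacency (host_graph h)) fs) -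
        (\<Sum>fs\<leftarrow>ns. quad_sum (adjacency (host_graph h)) fs)) div a \<and>
     (\<forall>t b. mem (run P h t) b \<le> (2 + input_size h) ^ e') \<and>
     running_time P h \<le> (\<Sum>i<length (edge_seq h). next_cost h i) + C * (1 + num_edges h ^ 2)"
    if h: "valid_host h" for h
  proof -
    define S where "S = 2 + input_size h"
    define D where "D = adjacency (host_graph h)"
    have D: "graph_relation D"
      using h graph_relation_adjacency unfolding D_def valid_host_def by blast
    have setD: "set (edge_seq h) = D" using h by (simp add: valid_host_def D_def adjacency_def)
    have S2: "2 \<le> S" by (simp add: S_def)
    have pw: "S ^ i \<le> S ^ j" if "i \<le> j" for i j using S2 that by (intro power_increasing) auto
    have two: "2 ^ i \<le> S ^ i" for i using S2 by (intro power_mono) auto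
    let ?l = "length (edge_seq h)"
    have l: "?l \<le> 2 * num_edges h" by (rule length_edge_seq[OF h])
    have lS: "2 * ?l + 2 \<le> S ^ 3"
    proof -
      have "2 * ?l + 2 \<le> 4 * S" using l by (simp add: S_def input_size_def)
      also have "\<dots> \<le> S ^ 2 * S" using two[of 2] by (intro mult_le_mono) auto
      finally show ?thesis by (simp add: power2_eq_square power3_eq_cube)
    qed
    have B3: "2 * ?l * (2 * ?l) + 2 \<le> S ^ 7"
    proof -
      have "2 * ?l * (2 * ?l) + 2 \<le> (2 * ?l + 2) * (2 * ?l + 2)" by (simp add: algebra_simps)
      also have "\<dots> \<le> S ^ 3 * S ^ 3" using lS by (intro mult_le_mono)
      also have "\<dots> = S ^ 6" by (simp flip: power_add)
      also have "\<dots> \<le> S ^ 7" by (rule pw) simp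
      finally show ?thesis .
    qed
    have B1: "16 \<le> S ^ 7" using two[of 4] pw[of 4 7] by simp
    have "S \<le> S ^ 7" using pw[of 1 7] by simp
    then have B2: "card (verts (host_graph h)) \<le> S ^ 7" by (simp add: S_def input_size_def)
    obtain m ds where m: "stored ds m" "m 3 = length ds * length ds" "tables (read_tables D) m"
      "distinct ds" "set ds = edge_pairs D" "length ds \<le> 2 * ?l" "\<forall>a. m a \<le> S ^ 7"
      and r1: "reach P h ((S ^ 7) ^ (2 ^ q)) init_state
       \<lparr>pc = L, mem = m, pos = ?l, clock = 4 + (\<Sum>i<?l. next_cost h i) + ?l * (q + 2)\<rparr>"
      using prelude_reach[OF code(1) h B1 B2 B3] unfolding setD q_def L_def by blast
    define s1 where "s1 = \<lparr>pc = L, mem = m, pos = ?l, clock = 4 + (\<Sum>i<?l. next_cost h i) + ?l * (q + 2)\<rparr>"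
    have dsl: "length ds * length ds \<le> 2 * ?l * (2 * ?l)" using m(6) by (intro mult_le_mono)
    then have "length ds * length ds \<le> S ^ 7" using B3 by linarith
    then obtain m' t where m': "tables (fold (pass (edge_pairs D)) uss (read_tables D)) m'"
      "\<forall>a. m' a \<le> S ^ e" "t \<le> c * (1 + length ds * length ds)"
      and r2: "reach P h (S ^ e) s1 (s1\<lparr>mem := m', pc := L + length (passes_code L uss), clock := clock s1 + t\<rparr>)"
      using passes[of S P s1 ds "read_tables D" h] S2 code(2) m B1 unfolding s1_def by auto
    define s2 where "s2 = s1\<lparr>mem := m', pc := L + length (passes_code L uss), clock := clock s1 + t\<rparr>"
    define B where "B = S ^ (e + a)"
    have aB: "a \<le> B"
    proof -
      have "a \<le> 2 ^ a" by (rule less_imp_le[OF less_exp])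
      also have "\<dots> \<le> S ^ (e + a)" using two[of a] pw[of a "e + a"] by linarith
      finally show ?thesis unfolding B_def .
    qed
    have m'B: "\<forall>b. m' b \<le> B" using m'(2) pw[of e "e + a"] unfolding B_def by (meson le_add1 order_trans)
    have "2 \<le> B" using e pw[of 1 "e + a"] S2 unfolding B_def by simp
    define s3 where "s3 = s2\<lparr>mem := fold eval [Sub 0 26 27, Const 13 a, Div 0 0 13] m',
      pc := L + length (passes_code L uss) + 3, clock := clock s2 + 3\<rparr>"
    have r3: "reach P h (B ^ 2 ^ 3) s2 s3"
      using straight_reach[of P s2 "[Sub 0 26 27, Const 13 a, Div 0 0 13]" B h] code(3) aB m'B \<open>2 \<le> B\<close>
      unfolding s3_def by (simp add: s2_def numeral_3_eq_3)
    have "(S ^ 7) ^ (2 ^ q) \<le> S ^ e'" "S ^ e \<le> S ^ e'" "B ^ 2 ^ 3 \<le> S ^ e'"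
      unfolding B_def power_mult[symmetric] by (rule pw, simp add: e'_def)+
    then have "reach P h (S ^ e') init_state s3"
      using reach_trans[OF reach_trans[OF reach_mono[OF r1] reach_mono[OF r2[unfolded s1_def]]]
          reach_mono[OF r3[unfolded s2_def s1_def]]] by blast
    moreover have "halted P s3" unfolding halted_def lenP s3_def by simp
    ultimately have fin: "halts P h" "final_state P h = s3" "\<And>t b. mem (run P h t) b \<le> S ^ e'"
      using reach_final by blast+
    have T: "fold (pass (edge_pairs D)) uss (read_tables D) =
       pass (edge_pairs D) (sum_pass ps ns) (walk_tables D 9)"
      using fold_walk_passes[OF D, of 9] by (simp add: uss_def read_tables_walks[OF D])
    have "m' (cell 10 0 0) = (\<Sum>fs\<leftarrow>ps. quad_sum D fs)" "m' (cell 11 0 0) = (\<Sum>fs\<leftarrow>ns. quad_sum D fs)"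
      using m'(1) pass_sum_pass[OF small, of D] unfolding T tables_def by simp_all
    then have res: "result P h = ((\<Sum>fs\<leftarrow>ps. quad_sum D fs) - (\<Sum>fs\<leftarrow>ns. quad_sum D fs)) div a"
      unfolding result_def fin(2) s3_def by (simp add: cell_def)
    have "running_time P h = 7 + (\<Sum>i<?l. next_cost h i) + ?l * (q + 2) + t"
      unfolding running_time_def fin(2) by (simp add: s3_def s2_def s1_def)
    also have "\<dots> \<le> (\<Sum>i<?l. next_cost h i) + C * (1 + num_edges h ^ 2)"
    proof -
      have lin: "num_edges h \<le> num_edges h ^ 2" by (simp add: power2_eq_square)
      have "?l * (q + 2) \<le> 2 * num_edges h ^ 2 * (q + 2)" using l lin by (intro mult_le_mono1) linarith
      moreover have "2 * ?l * (2 * ?l) \<le> 16 * num_edges h ^ 2"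
        using mult_le_mono[OF l l] by (simp add: power2_eq_square)
      then have "t \<le> c * (1 + 16 * num_edges h ^ 2)"
        using m'(3) dsl by (meson add_le_cancel_left le_trans mult_le_mono2)
      ultimately show ?thesis by (simp add: C_def algebra_simps)
    qed
    finally show ?thesis using fin res unfolding S_def D_def by blast
  qed
  then show ?thesis unfolding P_def by blast
qed

theorem theorem11:
  fixes R :: "host set" and k :: nat
  assumes "efficient_representation R"
    and "3 \<le> k" and "k \<le> 9"
  shows "computable_in_soft_O R
           (\<lambda>h. count_subgraphs (cycle_graph k) (host_graph h))
           (\<lambda>h. num_edges h ^ 2)"
proof -
  have k: "0 < k" using assms(2) by simp
  obtain ps ns where small: "\<forall>fs\<in>set (ps @ ns). small_factors fs"
    and card: "\<And>D. graph_relation D \<Longrightarrow> int (card (cycle_embeddings D k)) =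
       int (\<Sum>fs\<leftarrow>ps. quad_sum D fs) - int (\<Sum>fs\<leftarrow>ns. quad_sum D fs)"
    using card_cycle_embeddings[OF k assms(3)] by blast
  define a where "a = card (automorphisms (cycle_graph k))"
  have C: "simple_graph (cycle_graph k)" by (rule cycle_graph_simple[OF assms(2)])
  have a: "a > 0" unfolding a_def by (rule automorphisms_pos[OF C])
  define P where "P = cycle_program ps ns a"
  obtain e c where P: "\<And>h. valid_host h \<Longrightarrow> halts P h" "\<And>h. valid_host h \<Longrightarrow> result P h =
       ((\<Sum>fs\<leftarrow>ps. quad_sum (adjacency (host_graph h)) fs) -
        (\<Sum>fs\<leftarrow>ns. quad_sum (adjacency (host_graph h)) fs)) div a"
     "\<And>h t b. valid_host h \<Longrightarrow> mem (run P h t) b \<le> (2 + input_size h) ^ e"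
     "\<And>h. valid_host h \<Longrightarrow> running_time P h \<le>
       (\<Sum>i<length (edge_seq h). next_cost h i) + c * (1 + num_edges h ^ 2)"
    using cycle_program_correct[OF small, of a] unfolding P_def by blast
  have valid: "valid_host h" if "h \<in> R" for h
    using assms(1) that unfolding efficient_representation_def by blast
  have res: "result P h = count_subgraphs (cycle_graph k) (host_graph h)" if "h \<in> R" for h
  proof -
    have H: "simple_graph (host_graph h)" using valid[OF that] by (simp add: valid_host_def)
    \<comment> \<open>The integer difference is a cardinality, so the truncated subtraction is
      exact.\<close>
    have "(\<Sum>fs\<leftarrow>ps. quad_sum (adjacency (host_graph h)) fs) -
        (\<Sum>fs\<leftarrow>ns. quad_sum (adjacency (host_graph h)) fs) = card (cycle_embeddings (adjacency (host_graph h)) k)"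
      using card[OF graph_relation_adjacency[OF H]] by linarith
    also have "\<dots> = a * count_subgraphs (cycle_graph k) (host_graph h)"
      using card_embeddings[OF C H] unfolding embeddings_cycle_graph[OF assms(2) H] a_def .
    finally show ?thesis using P(2)[OF valid[OF that]] a by simp
  qed
  have "soft_O R input_size (running_time P) (\<lambda>h. num_edges h ^ 2)"
  proof -
    obtain c0 d where next_le: "\<And>h. h \<in> R \<Longrightarrow> real (\<Sum>i<length (edge_seq h). next_cost h i) \<le>
        c0 * (1 + real (num_edges h)) * log 2 (2 + real (input_size h)) ^ d"
      using assms(1) unfolding efficient_representation_def soft_O_def by blast
    \<comment> \<open>The absolute value guards against a negative \<open>c0\<close>; the factor 2
      comes from 1 + x \<le> 2 * (1 + x^2).\<close>
    have "real (running_time P h) \<le> (2 * \<bar>c0\<bar> + real c) * (1 + real (num_edges h ^ 2)) * log 2 (2 + real (input_size h)) ^ d"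
      if h: "h \<in> R" for h
    proof -
      define g where "g = log 2 (2 + real (input_size h)) ^ d"
      define x where "x = real (num_edges h)"
      \<comment> \<open>As the logarithm is at least 1, the polylogarithmic factor can also be
        attached to the cost of the program's own instructions.\<close>
      have "1 \<le> log 2 (2 + real (input_size h))" by (subst le_log_iff) auto
      then have g: "1 \<le> g" unfolding g_def by (rule one_le_power)
      have x: "0 \<le> x" unfolding x_def by simp
      have "num_edges h \<le> num_edges h ^ 2" by (simp add: power2_eq_square)
      then have "x \<le> x ^ 2" unfolding x_def by (metis of_nat_mono of_nat_power)
      then have x2: "1 + x \<le> 2 * (1 + x ^ 2)" using x by simp
      have "real (running_time P h) \<le> real (\<Sum>i<length (edge_seq h). next_cost h i) + real c * (1 + x ^ 2)"
        using P(4)[OF valid[OF h]] unfolding x_def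
        by (metis (mono_tags, lifting) of_nat_1 of_nat_add of_nat_mono of_nat_mult of_nat_power)
      also have "\<dots> \<le> c0 * (1 + x) * g + real c * (1 + x ^ 2)"
        using next_le[OF h] unfolding g_def x_def by simp
      also have "c0 * (1 + x) * g \<le> \<bar>c0\<bar> * (2 * (1 + x ^ 2)) * g"
        using g x x2 by (intro mult_mono) auto
      also have "real c * (1 + x ^ 2) \<le> real c * (1 + x ^ 2) * g"
        using g mult_left_mono[OF g, of "real c * (1 + x ^ 2)"] by simp
      finally show ?thesis unfolding g_def x_def by (simp add: algebra_simps)
    qed
    then show ?thesis unfolding soft_O_def by blast
  qed
  moreover have "logarithmic_words P R"
    unfolding logarithmic_words_def using P(3) valid by blast
  ultimately show ?thesis
    unfolding computable_in_soft_O_def using P(1) res valid by blast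
qed

end
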